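(* Let $u_0, f\in L^1_{loc}(\mathbb{R}^n)$ be complex-valued and let $\lambda\in\mathbb{C}\setminus\{0\}$, $\mu\in\mathbb{C}$. Write $\lambda_1=\Re(\lambda)$, $\lambda_2=\Im(\lambda)$, $\mu_1=\Re(\mu)$, $\mu_2=\Im(\mu)$, $f_1=\Re(f)$, $f_2=\Im(f)$. Consider the Cauchy problem $$iu_t+\Delta_x u=\lambda|u|^p+\mu|\nabla u|^q+f(x)\ \text{ in } (0,\infty)\times\mathbb{R}^n,\qquad u(0,x)=u_0(x),\ x\in\mathbb{R}^n. \qquad (P)$$ (a) Suppose $\mu=0$, $n\ge 3$, $p=\frac{n}{n-2}$, and $\lambda_i\int_{\mathbb{R}^n}f_i(x)\,dx>0$ for $i=1,2$. Then $(P)$ does not admit a global weak solution. (b) Suppose $\mu\in\mathbb{C}\setminus\{0\}$. If either (b1) $n\ge 3$, $p=\frac{n}{n-2}$, $q>1$, and $\lambda_i\mu_i\ge 0$, $\lambda_i\int_{\mathbb{R}^n}f_i(x)\,dx>0$ for $i=1,2$; or (b2) $n\ge 2$, $q=\frac{n}{n-1}$, $p>1$, and $\lambda_i\mu_i>0$, $\mu_i\int_{\mathbb{R}^n}f_i(x)\,dx>0$ for $i=1,2$, then $(P)$ admits no global weak solution.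
   Context: Solutions $u$ are complex-valued. The integrals $\int_{\mathbb{R}^n}f_i\,dx$ are Lebesgue integrals, whose existence is part of the hypotheses in which they appear. Weak solution when $\mu=0$ (used in part (a)): a function $u\in L^p_{loc}((0,T)\times\mathbb{R}^n)$ such that $$i\int_{\mathbb{R}^n}u_0(x)\varphi(0,x)\,dx+\int_0^T\int_{\mathbb{R}^n}\left[\lambda|u|^p+f(x)\right]\varphi\,dx\,dt=\int_0^T\int_{\mathbb{R}^n}u\,\Delta_x\varphi\,dx\,dt-i\int_0^T\int_{\mathbb{R}^n}u\,\varphi_t\,dx\,dt$$ for every compactly supported $0\le\varphi\in C^{1,2}_{t,x}((0,T)\times\mathbb{R}^n)$. Weak solution when $\mu\ne 0$ (used in part (b)): a function $u\in L^p_{loc}((0,T)\times\mathbb{R}^n)$ with weak spatial gradient $\nabla u\in L^q_{loc}((0,T)\times\mathbb{R}^n)$ such that $$i\int_{\mathbb{R}^n}u_0(x)\varphi(0,x)\,dx+\int_0^T\int_{\mathbb{R}^n}\left[\lambda|u|^p+\mu|\nabla u|^q+f(x)\right]\varphi\,dx\,dt=-\int_0^T\int_{\mathbb{R}^n}\nabla u\cdot\nabla\varphi\,dx\,dt-i\int_0^T\int_{\mathbb{R}^n}u\,\varphi_t\,dx\,dt$$ for every compactly supported $0\le\varphi\in C^{1,2}_{t,x}((0,T)\times\mathbb{R}^n)$. Here $C^{1,2}_{t,x}$ means $C^1$ in $t$ and $C^2$ in $x$ (real-valued functions), and $\varphi(0,\cdot)$ is the value at $t=0$ of the extension of $\varphi$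 by zero. A global weak solution is a function $u$ on $(0,\infty)\times\mathbb{R}^n$ that is a weak solution on $(0,T)\times\mathbb{R}^n$ for every $T>0$. *)

theory Defs
  imports "HOL-Analysis.Analysis"
begin

text \<open>Functions on space-time are functions of pairs \<open>(t, x)\<close>. A function on an open set
  \<open>\<Omega>\<close> is given by a total function of which only the values on \<open>\<Omega>\<close> matter.\<close>

definition Lp_loc :: "real \<Rightarrow> 'a::euclidean_space set \<Rightarrow> ('a \<Rightarrow> 'b::euclidean_space) \<Rightarrow> bool" where
  "Lp_loc p \<Omega> v \<longleftrightarrow>
     v \<in> borel_measurable (lebesgue_on \<Omega>) \<and>
     (\<forall>K. compact K \<and> K \<subseteq> \<Omega> \<longrightarrow> set_integrable lebesgue K (\<lambda>z. norm (v z) powr p))"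

definition cylinder :: "real \<Rightarrow> (real \<times> (real ^ 'n)) set" where
  "cylinder T = {0<..<T} \<times> UNIV"

definition spacetime_integral ::
    "real \<Rightarrow> (real \<times> (real ^ 'n) \<Rightarrow> complex) \<Rightarrow> complex" where
  "spacetime_integral T h = (LINT t:{0<..<T}|lebesgue. (LINT x|lebesgue. h (t, x)))"

definition dir_differentiable :: "'a::real_normed_vector \<Rightarrow> ('a \<Rightarrow> real) \<Rightarrow> 'a \<Rightarrow> bool" where
  "dir_differentiable b \<phi> z \<longleftrightarrow> (\<lambda>s::real. \<phi> (z + s *\<^sub>R b)) differentiable (at 0)"

definition dir_deriv :: "'a::real_normed_vector \<Rightarrow> ('a \<Rightarrow> real) \<Rightarrow> 'a \<Rightarrow> real" where
  "dir_deriv b \<phi> z = deriv (\<lambda>s::real. \<phi> (z + s *\<^sub>R b)) 0"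

definition time_dir :: "real \<times> (real ^ 'n)" where
  "time_dir = (1, 0)"

definition space_dir :: "'n::finite \<Rightarrow> real \<times> (real ^ 'n)" where
  "space_dir i = (0, axis i 1)"

text \<open>\<open>C\<^sup>k\<close> on an open set: all partial derivatives up to order \<open>k\<close> exist and are continuous.\<close>

primrec Ck_on :: "nat \<Rightarrow> 'a::euclidean_space set \<Rightarrow> ('a \<Rightarrow> real) \<Rightarrow> bool" where
  "Ck_on 0 \<Omega> \<phi> \<longleftrightarrow> continuous_on \<Omega> \<phi>"
| "Ck_on (Suc k) \<Omega> \<phi> \<longleftrightarrow> continuous_on \<Omega> \<phi> \<and>
     (\<forall>b\<in>Basis. (\<forall>z\<in>\<Omega>. dir_differentiable b \<phi> z) \<and> Ck_on k \<Omega> (dir_deriv b \<phi>))"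

definition smooth_on :: "'a::euclidean_space set \<Rightarrow> ('a \<Rightarrow> real) \<Rightarrow> bool" where
  "smooth_on \<Omega> \<phi> \<longleftrightarrow> (\<forall>k. Ck_on k \<Omega> \<phi>)"

text \<open>\<open>C\<^sup>1\<^sup>,\<^sup>2\<close> on an open set of space-time: \<open>\<phi>\<close>, \<open>\<phi>\<^sub>t\<close>, \<open>\<partial>\<^sub>i\<phi>\<close> and \<open>\<partial>\<^sub>j\<partial>\<^sub>i\<phi>\<close> exist and are
  continuous in \<open>(t, x)\<close>.\<close>

definition C12_on :: "(real \<times> (real ^ 'n)) set \<Rightarrow> (real \<times> (real ^ 'n) \<Rightarrow> real) \<Rightarrow> bool" where
  "C12_on \<Omega> \<phi> \<longleftrightarrow>
     continuous_on \<Omega> \<phi> \<and>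
     (\<forall>z\<in>\<Omega>. dir_differentiable time_dir \<phi> z) \<and> continuous_on \<Omega> (dir_deriv time_dir \<phi>) \<and>
     (\<forall>i. (\<forall>z\<in>\<Omega>. dir_differentiable (space_dir i) \<phi> z) \<and>
          continuous_on \<Omega> (dir_deriv (space_dir i) \<phi>) \<and>
          (\<forall>j. (\<forall>z\<in>\<Omega>. dir_differentiable (space_dir j) (dir_deriv (space_dir i) \<phi>) z) \<and>
               continuous_on \<Omega> (dir_deriv (space_dir j) (dir_deriv (space_dir i) \<phi>))))"

definition space_laplacian :: "(real \<times> (real ^ 'n) \<Rightarrow> real) \<Rightarrow> real \<times> (real ^ 'n) \<Rightarrow> real" where
  "space_laplacian \<phi> z = (\<Sum>i\<in>UNIV. dir_deriv (space_dir i) (dir_deriv (space_dir i) \<phi>) z)"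

text \<open>The support is taken in the whole space, so \<open>\<phi>\<close> is extended by zero outside \<open>\<Omega>\<close>.\<close>

definition compactly_supported_in :: "'a::euclidean_space set \<Rightarrow> ('a \<Rightarrow> real) \<Rightarrow> bool" where
  "compactly_supported_in \<Omega> \<phi> \<longleftrightarrow>
     compact (closure {z. \<phi> z \<noteq> 0}) \<and> closure {z. \<phi> z \<noteq> 0} \<subseteq> \<Omega>"

definition test_function :: "real \<Rightarrow> (real \<times> (real ^ 'n) \<Rightarrow> real) \<Rightarrow> bool" where
  "test_function T \<phi> \<longleftrightarrow>
     C12_on (cylinder T) \<phi> \<and> compactly_supported_in (cylinder T) \<phi> \<and> (\<forall>z. 0 \<le> \<phi> z)"

definition weak_spatial_gradient ::
    "real \<Rightarrow> (real \<times> (real ^ 'n) \<Rightarrow> complex) \<Rightarrow> (real \<times> (real ^ 'n) \<Rightarrow> complex ^ 'n) \<Rightarrow> bool" where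
  "weak_spatial_gradient T u g \<longleftrightarrow>
     Lp_loc 1 (cylinder T) u \<and> Lp_loc 1 (cylinder T) g \<and>
     (\<forall>\<psi> i. smooth_on (cylinder T) \<psi> \<and> compactly_supported_in (cylinder T) \<psi> \<longrightarrow>
        spacetime_integral T (\<lambda>z. u z * of_real (dir_deriv (space_dir i) \<psi> z)) =
        - spacetime_integral T (\<lambda>z. g z $ i * of_real (\<psi> z)))"

definition weak_solution_zero ::
    "complex \<Rightarrow> real \<Rightarrow> (real ^ 'n \<Rightarrow> complex) \<Rightarrow> (real ^ 'n \<Rightarrow> complex) \<Rightarrow> real \<Rightarrow>
     (real \<times> (real ^ 'n) \<Rightarrow> complex) \<Rightarrow> bool" where
  "weak_solution_zero lam p f u0 T u \<longleftrightarrow>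
     Lp_loc p (cylinder T) u \<and>
     (\<forall>\<phi>. test_function T \<phi> \<longrightarrow>
        \<i> * (LINT x|lebesgue. u0 x * of_real (\<phi> (0, x))) +
        spacetime_integral T (\<lambda>z. (lam * of_real (norm (u z) powr p) + f (snd z)) * of_real (\<phi> z)) =
        spacetime_integral T (\<lambda>z. u z * of_real (space_laplacian \<phi> z)) -
        \<i> * spacetime_integral T (\<lambda>z. u z * of_real (dir_deriv time_dir \<phi> z)))"

definition weak_solution_nonzero ::
    "complex \<Rightarrow> complex \<Rightarrow> real \<Rightarrow> real \<Rightarrow> (real ^ 'n \<Rightarrow> complex) \<Rightarrow> (real ^ 'n \<Rightarrow> complex) \<Rightarrow> real \<Rightarrow>
     (real \<times> (real ^ 'n) \<Rightarrow> complex) \<Rightarrow> bool" where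
  "weak_solution_nonzero lam mu p q f u0 T u \<longleftrightarrow>
     Lp_loc p (cylinder T) u \<and>
     (\<exists>g. weak_spatial_gradient T u g \<and> Lp_loc q (cylinder T) g \<and>
       (\<forall>\<phi>. test_function T \<phi> \<longrightarrow>
          \<i> * (LINT x|lebesgue. u0 x * of_real (\<phi> (0, x))) +
          spacetime_integral T (\<lambda>z. (lam * of_real (norm (u z) powr p) +
             mu * of_real (norm (g z) powr q) + f (snd z)) * of_real (\<phi> z)) =
          - spacetime_integral T (\<lambda>z. \<Sum>i\<in>UNIV. g z $ i * of_real (dir_deriv (space_dir i) \<phi> z)) -
          \<i> * spacetime_integral T (\<lambda>z. u z * of_real (dir_deriv time_dir \<phi> z))))"

definition global_weak_solution ::
    "complex \<Rightarrow> complex \<Rightarrow> real \<Rightarrow> real \<Rightarrow> (real ^ 'n \<Rightarrow> complex) \<Rightarrow> (real ^ 'n \<Rightarrow> complex) \<Rightarrow>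
     (real \<times> (real ^ 'n) \<Rightarrow> complex) \<Rightarrow> bool" where
  "global_weak_solution lam mu p q f u0 u \<longleftrightarrow>
     (\<forall>T>0. if mu = 0 then weak_solution_zero lam p f u0 T u
            else weak_solution_nonzero lam mu p q f u0 T u)"

end

theory Submission
  imports Defs
begin

text \<open>Test the real part of the equation with \<open>\<phi>(t,x) = H(a(t/T)) H(1 - ln(1 + |x|\<^sup>2)/L)\<close>, where
  \<open>H(s) = exp(-1/s)\<close> for \<open>s > 0\<close> and \<open>H(s) = 0\<close> otherwise, and \<open>a\<close> is a parabola that is positive on
  \<open>(1/4, 3/4)\<close>. The logarithm makes \<open>\<nabla>\<phi>\<close> and \<open>\<Delta>\<phi>\<close> of size
  \<open>1/(L|x|)\<close> and \<open>1/(L|x|\<^sup>2)\<close>, so after absorbing the solution by Young's inequality the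
  remainder at the critical exponent is \<open>T\<close> times \<open>L\<^bsup>-m\<^esup> \<integral> (1 + |x|\<^sup>2)\<^bsup>-n/2\<^esup> dx\<close>
  over \<open>1 + |x|\<^sup>2 < e\<^sup>L\<close>, with \<open>m > 1\<close>; the integral is of order \<open>L\<close>. Choosing \<open>T = e\<^bsup>nL\<^esup>\<close>
  makes the time derivative negligible, and \<open>L \<longrightarrow> \<infinity>\<close> gives that the
  signed integral of \<open>Re f\<close> is at most \<open>0\<close>. As \<open>\<phi>\<close> is smooth,
  its derivatives may be inserted into the definition of the weak gradient, which reduces (b1) to the
  estimate for (a).\<close>

section \<open>Fubini and integrability for Lebesgue measurable functions\<close>

text \<open>At the critical exponent a cutoff in |x|/R gives a remainder that stays bounded but does
  not vanish as R grows: all shells of a fixed radius ratio carry comparable shares of the weight (1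
  + |x|^2)^(-n/2). The logarithm spreads the descent over L such shells, each damped by L^(-m), so
  that L^(1-m) remains. Here m is the conjugate exponent: n/2 for p = n/(n-2), and n for q =
  n/(n-1). Taking exp(-1/s) instead of a power of a bump lets one cutoff serve \<kappa> = 1/p and
  \<kappa> = 1/q alike, with no power to be adapted to p or q. The source does not depend on time,
  so its contribution and the main remainder are both proportional to T; the factor T cancels, and T
  may outgrow the volume of the support. A technical obstacle lies in the weak formulation: its
  integrals are iterated Lebesgue integrals of functions that are only Lebesgue measurable, so
  Fubini has to pass through Borel representatives.\<close>

lemma lebesgue_measurable_cong_AE:
  fixes f g :: "'a::euclidean_space \<Rightarrow> 'b::topological_space"
  assumes "g \<in> borel_measurable lebesgue" "AE x in lebesgue. f x = g x"
  shows "f \<in> borel_measurable lebesgue"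
proof (rule measurableI)
  obtain N where N: "N \<in> null_sets lebesgue" "{x. f x \<noteq> g x} \<subseteq> N"
    using assms(2) unfolding eventually_ae_filter by auto
  fix A :: "'b set" assume A: "A \<in> sets borel"
  have "f -` A = (g -` A - N) \<union> (f -` A \<inter> N)" using N(2) by auto
  moreover have "g -` A \<in> sets lebesgue" using measurable_sets[OF assms(1) A] by simp
  \<comment> \<open>Completeness enters here: every subset of the null set \<open>N\<close> is
    Lebesgue measurable.\<close>
  moreover have "f -` A \<inter> N \<in> sets lebesgue"
    using null_sets_completion_subset[of "f -` A \<inter> N" N lborel] N(1) by auto
  ultimately have "f -` A \<in> sets lebesgue"
    using null_setsD2[OF N(1)] by (metis (no_types, lifting) sets.Diff sets.Un)
  then show "f -` A \<inter> space lebesgue \<in> sets lebesgue" by simp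
qed auto

text \<open>The real-valued case is applied to each coordinate; the finitely many exceptional null
  sets unite to a null set.\<close>

lemma lebesgue_ex_borel_measurable:
  fixes f :: "'a::euclidean_space \<Rightarrow> 'b::euclidean_space"
  assumes "f \<in> borel_measurable lebesgue"
  obtains g where "g \<in> borel_measurable borel" "AE x in lborel. f x = g x"
proof -
  have "\<exists>g\<in>borel_measurable lborel. AE x in lborel. f x \<bullet> b = g x" for b
    using assms by (intro completion_ex_borel_measurable_real) auto
  then obtain g where g: "\<And>b. g b \<in> borel_measurable lborel"
      "\<And>b. AE x in lborel. f x \<bullet> b = g b x"
    by metis
  have "AE x in lborel. \<forall>b\<in>Basis. f x \<bullet> b = g b x"
    using g(2) by (intro AE_finite_allI) auto
  then have "AE x in lborel. f x = (\<Sum>b\<in>Basis. g b x *\<^sub>R b)"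
  proof eventually_elim
    case (elim x)
    have "f x = (\<Sum>b\<in>Basis. (f x \<bullet> b) *\<^sub>R b)" by (simp add: euclidean_representation)
    also have "\<dots> = (\<Sum>b\<in>Basis. g b x *\<^sub>R b)" using elim by (intro sum.cong) auto
    finally show ?case .
  qed
  moreover have "(\<lambda>x. \<Sum>b\<in>Basis. g b x *\<^sub>R b) \<in> borel_measurable borel"
    using g(1) by (intro borel_measurable_sum borel_measurable_scaleR) auto
  ultimately show ?thesis using that by blast
qed

text \<open>Measurability of \<open>f\<close> is derived from the almost everywhere equality, not
  assumed. This matters for inner integrals, whose dependence on the outer variable is not known to
  be measurable beforehand.\<close>

lemma lebesgue_integral_cong_lborel:
  fixes f g :: "'a::euclidean_space \<Rightarrow> 'b::euclidean_space"
  assumes "g \<in> borel_measurable borel" "AE x in lborel. f x = g x"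
  shows "integral\<^sup>L lebesgue f = integral\<^sup>L lborel g"
    and "integrable lebesgue f \<longleftrightarrow> integrable lborel g"
proof -
  have g: "g \<in> borel_measurable lborel" using assms(1) by simp
  then have gl: "g \<in> borel_measurable lebesgue" by (rule measurable_completion)
  have ae: "AE x in lebesgue. f x = g x" using assms(2) by (rule AE_completion)
  have fl: "f \<in> borel_measurable lebesgue" using gl ae by (rule lebesgue_measurable_cong_AE)
  show "integral\<^sup>L lebesgue f = integral\<^sup>L lborel g"
    using integral_cong_AE[OF fl gl ae] integral_completion[OF g] by simp
  show "integrable lebesgue f \<longleftrightarrow> integrable lborel g"
    using integrable_cong_AE[OF fl gl ae] integrable_completion[OF g] by simp
qed

text \<open>For almost every \<open>x\<close> the slice of \<open>h\<close> agrees almost everywhere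
  with the slice of a Borel representative \<open>g\<close>. Hence the inner integrals agree for
  almost every \<open>x\<close>, and Fubini for \<open>g\<close> concludes.\<close>

lemma lebesgue_integral_fst:
  fixes h :: "'a::euclidean_space \<times> 'b::euclidean_space \<Rightarrow> 'c::euclidean_space"
  assumes "integrable lebesgue h"
  shows "(LINT x|lebesgue. LINT y|lebesgue. h (x, y)) = (LINT z|lebesgue. h z)"
proof -
  obtain g where g: "g \<in> borel_measurable borel" "AE z in lborel. h z = g z"
    using lebesgue_ex_borel_measurable[of h] assms by auto
  have gi: "integrable (lborel \<Otimes>\<^sub>M lborel) g"
    using assms lebesgue_integral_cong_lborel(2)[OF g] by (simp add: lborel_prod)
  have gx: "(\<lambda>y. g (x, y)) \<in> borel_measurable borel" for x
    using measurable_compose[OF measurable_Pair1' g(1)[folded borel_prod], of x] by simp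
  have "AE x in lborel. AE y in lborel. h (x, y) = g (x, y)"
    using lborel_pair.AE_pair[of "\<lambda>z. h z = g z"] g(2) unfolding lborel_prod by blast
  then have ae: "AE x in lborel. (LINT y|lebesgue. h (x, y)) = (LINT y|lborel. g (x, y))"
    by eventually_elim (rule lebesgue_integral_cong_lborel(1)[OF gx])
  have "(\<lambda>x. LINT y|lborel. g (x, y)) \<in> borel_measurable borel"
    using borel_measurable_integrable[OF lborel_pair.integrable_fst'[OF gi]] by simp
  from lebesgue_integral_cong_lborel(1)[OF this ae]
  have "(LINT x|lebesgue. LINT y|lebesgue. h (x, y)) = (LINT x|lborel. LINT y|lborel. g (x, y))" .
  also have "\<dots> = integral\<^sup>L lborel g"
    using lborel_pair.integral_fst'[OF gi] by (simp add: lborel_prod)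
  also have "\<dots> = (LINT z|lebesgue. h z)"
    using lebesgue_integral_cong_lborel(1)[OF g] by simp
  finally show ?thesis .
qed

text \<open>Serves the source term, where a function of \<open>x\<close> alone is only Lebesgue
  measurable. Fubini gives integrability for a Borel representative of \<open>f\<close>; the two
  differ over a null set of \<open>x\<close>, and the cylinder over it is null in the
  product.\<close>

lemma integrable_lebesgue_tensor:
  fixes a :: "'a::euclidean_space \<Rightarrow> real" and f :: "'b::euclidean_space \<Rightarrow> 'c::euclidean_space"
  assumes a: "a \<in> borel_measurable borel" "integrable lborel a" and f: "integrable lebesgue f"
  shows "integrable lebesgue (\<lambda>z. a (fst z) *\<^sub>R f (snd z))"
proof -
  obtain g where g: "g \<in> borel_measurable borel" "AE x in lborel. f x = g x"
    using lebesgue_ex_borel_measurable[of f] f by auto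
  have gi: "integrable lborel g" using f lebesgue_integral_cong_lborel(2)[OF g] by simp
  have m: "(\<lambda>z. a (fst z) *\<^sub>R g (snd z)) \<in> borel_measurable (lborel \<Otimes>\<^sub>M lborel)"
    using a(1) g(1) by (intro borel_measurable_scaleR measurable_compose[OF measurable_fst]
        measurable_compose[OF measurable_snd]) auto
  have i: "integrable (lborel \<Otimes>\<^sub>M lborel) (\<lambda>z. a (fst z) *\<^sub>R g (snd z))"
  proof (rule lborel_pair.Fubini_integrable[OF m])
    show "integrable lborel (\<lambda>x. LINT y|lborel. norm (a (fst (x, y)) *\<^sub>R g (snd (x, y))))"
      using a by simp
    show "AE x in lborel. integrable lborel (\<lambda>y. a (fst (x, y)) *\<^sub>R g (snd (x, y)))"
      using gi by simp
  qed
  \<comment> \<open>\<open>N\<close> is Borel, which makes the cylinder over it measurable in the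
    product; its slices are all equal to \<open>N\<close>, hence null.\<close>
  obtain N where N: "N \<in> null_sets lborel" "{x. f x \<noteq> g x} \<subseteq> N"
    using g(2) unfolding eventually_ae_filter by auto
  have N': "AE x in lborel. x \<notin> N" using N(1) by (rule AE_not_in)
  have "AE z in lborel \<Otimes>\<^sub>M lborel. snd (z :: 'a \<times> 'b) \<notin> N"
  proof (rule lborel_pair.AE_pair_measure)
    have "{z \<in> space (lborel \<Otimes>\<^sub>M lborel). snd (z :: 'a \<times> 'b) \<notin> N} = UNIV \<times> (- N)"
      by (auto simp: space_pair_measure)
    moreover have "N \<in> sets borel" using N(1) by (auto simp: null_sets_def)
    ultimately show "{z \<in> space (lborel \<Otimes>\<^sub>M lborel). snd (z :: 'a \<times> 'b) \<notin> N} \<in> sets (lborel \<Otimes>\<^sub>M lborel)"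
      by (auto intro!: pair_measureI)
  qed (use N' in simp)
  then have "AE z in lborel. a (fst z) *\<^sub>R f (snd z) = a (fst z) *\<^sub>R g (snd z)"
    unfolding lborel_prod by eventually_elim (use N(2) in auto)
  from lebesgue_integral_cong_lborel(2)[OF _ this] i m show ?thesis
    by (simp add: lborel_prod)
qed

lemma lebesgue_integral_tensor:
  fixes a :: "'a::euclidean_space \<Rightarrow> real" and f :: "'b::euclidean_space \<Rightarrow> 'c::euclidean_space"
  assumes "a \<in> borel_measurable borel" "integrable lborel a" "integrable lebesgue f"
  shows "(LINT z|lebesgue. a (fst z) *\<^sub>R f (snd z)) = (LINT t|lborel. a t) *\<^sub>R (LINT x|lebesgue. f x)"
proof -
  have "(LINT z|lebesgue. a (fst z) *\<^sub>R f (snd z)) = (LINT t|lebesgue. a t *\<^sub>R (LINT x|lebesgue. f x))"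
    using lebesgue_integral_fst[OF integrable_lebesgue_tensor[OF assms]] assms(3) by simp
  also have "\<dots> = (LINT t|lebesgue. a t) *\<^sub>R (LINT x|lebesgue. f x)"
    using assms(1,2) integrable_completion[of a lborel] by (intro integral_scaleR_left) auto
  finally show ?thesis using integral_completion[of a lborel] assms(1) by simp
qed

lemma spacetime_integral_eq:
  assumes "integrable lebesgue h" "\<And>z. z \<notin> cylinder T \<Longrightarrow> h z = 0"
  shows "spacetime_integral T h = (LINT z|lebesgue. h z)"
proof -
  have "indicator {0<..<T} t *\<^sub>R (LINT x|lebesgue. h (t, x)) = (LINT x|lebesgue. h (t, x))" for t
    using assms(2)[of "(t, _)"] by (cases "t \<in> {0<..<T}") (auto simp: cylinder_def)
  then show ?thesis
    unfolding spacetime_integral_def set_lebesgue_integral_def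
    using lebesgue_integral_fst[OF assms(1)] by simp
qed

lemma integrable_lebesgue_cutoff:
  fixes u :: "'a::euclidean_space \<Rightarrow> 'b::euclidean_space" and \<psi> :: "'a \<Rightarrow> real"
  assumes u: "u \<in> borel_measurable (lebesgue_on \<Omega>)" "set_integrable lebesgue K (\<lambda>z. norm (u z))"
    and K: "compact K" "K \<subseteq> \<Omega>" and \<psi>: "continuous_on UNIV \<psi>" "\<And>z. z \<notin> K \<Longrightarrow> \<psi> z = 0"
  shows "integrable lebesgue (\<lambda>z. \<psi> z *\<^sub>R u z)"
proof -
  have Ks: "K \<in> sets lebesgue" using K(1) by (simp add: borel_compact)
  have "u \<in> borel_measurable (lebesgue_on K)" by (rule measurable_restrict_mono[OF u(1) K(2)])
  then have m: "(\<lambda>z. indicator K z *\<^sub>R u z) \<in> borel_measurable lebesgue"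
    using Ks by (simp add: borel_measurable_restrict_space_iff)
  have "compact (\<psi> ` K)"
    by (intro compact_continuous_image K continuous_on_subset[OF \<psi>(1)]) auto
  from compact_imp_bounded[OF this] obtain B where B: "\<And>z. z \<in> K \<Longrightarrow> \<bar>\<psi> z\<bar> \<le> B"
    unfolding bounded_iff by (metis (no_types, lifting) imageI real_norm_def)
  \<comment> \<open>Off \<Omega> the values of \<open>u\<close> are arbitrary. The indicator of
    \<open>K\<close> replaces \<open>u\<close> by a function that is measurable on the whole
    space.\<close>
  have eq: "\<psi> z *\<^sub>R u z = \<psi> z *\<^sub>R (indicator K z *\<^sub>R u z)" for z
    using \<psi>(2)[of z] by (cases "z \<in> K") auto
  show ?thesis
  proof (rule Bochner_Integration.integrable_bound)
    show "integrable lebesgue (\<lambda>z. B * (indicator K z *\<^sub>R norm (u z)))"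
      using u(2) by (auto simp: set_integrable_def)
    have "\<psi> \<in> borel_measurable lebesgue"
      using borel_measurable_continuous_onI[OF \<psi>(1)] by (simp add: measurable_completion)
    then show "(\<lambda>z. \<psi> z *\<^sub>R u z) \<in> borel_measurable lebesgue"
      unfolding eq by (intro borel_measurable_scaleR m)
    have "\<bar>\<psi> z\<bar> * norm (u z) \<le> \<bar>B\<bar> * norm (u z)" if "z \<in> K" for z
      using B[OF that] by (intro mult_right_mono) auto
    then show "AE z in lebesgue. norm (\<psi> z *\<^sub>R u z) \<le> norm (B * (indicator K z *\<^sub>R norm (u z)))"
      using \<psi>(2) by (intro AE_I2) (auto simp: indicator_def abs_mult)
  qed
qed

text \<open>From t \<le> 1 + t^p for t \<ge> 0 and p \<ge> 1, as constants are integrable over the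
  compact \<open>K\<close>.\<close>

lemma Lp_loc_imp_L1_loc:
  assumes "Lp_loc p \<Omega> v" "p \<ge> 1"
  shows "Lp_loc 1 \<Omega> v"
  unfolding Lp_loc_def
proof (intro conjI allI impI)
  show m: "v \<in> borel_measurable (lebesgue_on \<Omega>)" using assms(1) by (simp add: Lp_loc_def)
  fix K assume K: "compact K \<and> K \<subseteq> \<Omega>"
  have Ks: "K \<in> sets lebesgue" using K by (simp add: borel_compact)
  have "v \<in> borel_measurable (lebesgue_on K)" using measurable_restrict_mono[OF m] K by blast
  then have "(\<lambda>z. norm (v z) powr 1) \<in> borel_measurable (lebesgue_on K)" by measurable
  then have m': "(\<lambda>z. indicator K z *\<^sub>R norm (v z) powr 1) \<in> borel_measurable lebesgue"
    using Ks by (simp add: borel_measurable_restrict_space_iff)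
  have "integrable lebesgue (indicator K :: _ \<Rightarrow> real)"
    using K fmeasurable_compact[of K] by (simp add: fmeasurable_def integrable_indicator_iff)
  moreover have "integrable lebesgue (\<lambda>z. indicator K z *\<^sub>R norm (v z) powr p)"
    using assms(1) K by (auto simp: Lp_loc_def set_integrable_def)
  ultimately have i: "integrable lebesgue (\<lambda>z. indicator K z + indicator K z *\<^sub>R norm (v z) powr p)"
    by (rule Bochner_Integration.integrable_add)
  have "norm (v z) powr 1 \<le> 1 + norm (v z) powr p" for z
  proof (cases "norm (v z) \<le> 1")
    case True
    then show ?thesis using add_mono[OF True powr_ge_zero[of "norm (v z)" p]] by simp
  next
    case False
    then show ?thesis using powr_mono[of 1 p "norm (v z)"] assms(2) by simp
  qed
  then have "AE z in lebesgue. norm (indicator K z *\<^sub>R norm (v z) powr 1)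
      \<le> norm (indicator K z + indicator K z *\<^sub>R norm (v z) powr p)"
    by (intro AE_I2) (auto simp: indicator_def)
  from Bochner_Integration.integrable_bound[OF i m' this]
  show "set_integrable lebesgue K (\<lambda>z. norm (v z) powr 1)"
    unfolding set_integrable_def .
qed

lemma integrable_Lp_loc_cutoff:
  fixes u :: "'a::euclidean_space \<Rightarrow> 'b::euclidean_space" and \<psi> :: "'a \<Rightarrow> real"
  assumes u: "Lp_loc p \<Omega> u" and K: "compact K" "K \<subseteq> \<Omega>"
    and \<psi>: "continuous_on UNIV \<psi>" "\<And>z. z \<notin> K \<Longrightarrow> \<psi> z = 0"
  shows "integrable lebesgue (\<lambda>z. \<psi> z * norm (u z) powr p)"
    and "p \<ge> 1 \<Longrightarrow> integrable lebesgue (\<lambda>z. \<psi> z *\<^sub>R u z)"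
proof -
  have "(\<lambda>z. norm (u z) powr p) \<in> borel_measurable (lebesgue_on \<Omega>)"
    using u unfolding Lp_loc_def by (auto intro: measurable_compose)
  then show "integrable lebesgue (\<lambda>z. \<psi> z * norm (u z) powr p)"
    using integrable_lebesgue_cutoff[OF _ _ K \<psi>, of "\<lambda>z. norm (u z) powr p"] u K
    by (simp add: Lp_loc_def)
  show "integrable lebesgue (\<lambda>z. \<psi> z *\<^sub>R u z)" if "p \<ge> 1"
    using Lp_loc_imp_L1_loc[OF u that] K
    by (intro integrable_lebesgue_cutoff[OF _ _ K \<psi>]) (auto simp: Lp_loc_def)
qed

lemma has_bochner_integral_indicator_slab:
  assumes "a \<le> b" "0 \<le> R"
  shows "has_bochner_integral lebesgue (indicator ({a..b} \<times> cball (0 :: 'a::euclidean_space) R))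
    ((b - a) * unit_ball_vol (DIM('a)) * R ^ DIM('a))"
proof -
  let ?S = "{a..b} \<times> cball (0::'a) R"
  have S: "?S \<in> sets lborel" by (simp add: borel_Times borel_closed)
  have "emeasure lborel ?S = emeasure (lborel \<Otimes>\<^sub>M lborel) ?S" by (simp add: lborel_prod)
  also have "\<dots> = emeasure lborel {a..b} * emeasure lborel (cball (0::'a) R)"
    by (rule lborel.emeasure_pair_measure_Times) auto
  also have "\<dots> = ennreal ((b - a) * unit_ball_vol (DIM('a)) * R ^ DIM('a))"
    using assms by (simp add: emeasure_cball ennreal_mult mult.assoc)
  finally have e: "emeasure lborel ?S = ennreal ((b - a) * unit_ball_vol (DIM('a)) * R ^ DIM('a))" .
  have "has_bochner_integral lborel (indicator ?S) (measure lborel ?S)"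
    using S e by (intro has_bochner_integral_real_indicator) auto
  then have "has_bochner_integral lborel (indicator ?S) ((b - a) * unit_ball_vol (DIM('a)) * R ^ DIM('a))"
    using e assms by (simp add: measure_def)
  then show ?thesis
    using S lebesgue_integral_cong_lborel[of "indicator ?S :: _ \<Rightarrow> real" "indicator ?S"]
    by (simp add: has_bochner_integral_iff)
qed

section \<open>Smooth functions defined by directional derivatives\<close>

lemma dir_derivI:
  assumes "((\<lambda>s. \<phi> (z + s *\<^sub>R b)) has_real_derivative D) (at 0)"
  shows "dir_differentiable b \<phi> z" and "dir_deriv b \<phi> z = D"
  using assms unfolding dir_differentiable_def dir_deriv_def
  by (auto intro: DERIV_imp_deriv differentiableI simp: real_differentiable_def)

lemma dir_derivD:
  assumes "dir_differentiable b \<phi> z"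
  shows "((\<lambda>s. \<phi> (z + s *\<^sub>R b)) has_real_derivative dir_deriv b \<phi> z) (at 0)"
  using assms unfolding dir_differentiable_def dir_deriv_def
  by (metis DERIV_deriv_iff_real_differentiable)

text \<open>A derivative along a line sees only values near \<open>z\<close>, and the line stays in
  the open set \<Omega> for small \<open>s\<close>.\<close>

lemma line_has_derivative_cong:
  fixes z b :: "'a::euclidean_space"
  assumes "open \<Omega>" "z \<in> \<Omega>" "\<And>y. y \<in> \<Omega> \<Longrightarrow> \<phi> y = \<psi> y"
    "((\<lambda>s. \<phi> (z + s *\<^sub>R b)) has_real_derivative D) (at 0)"
  shows "((\<lambda>s. \<psi> (z + s *\<^sub>R b)) has_real_derivative D) (at 0)"
proof -
  let ?S = "(\<lambda>s::real. z + s *\<^sub>R b) -` \<Omega>"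
  have "open ?S"
    by (rule open_vimage[OF assms(1)]) (intro continuous_intros)
  moreover have "0 \<in> ?S" using assms by simp
  ultimately have "eventually (\<lambda>s. s \<in> ?S) (nhds 0)" by (rule eventually_nhds_in_open)
  then have "eventually (\<lambda>s. \<phi> (z + s *\<^sub>R b) = \<psi> (z + s *\<^sub>R b)) (nhds 0)"
    by (rule eventually_mono) (use assms(3) in auto)
  from DERIV_cong_ev[OF refl this refl] assms(4) show ?thesis by blast
qed

text \<open>\<open>dir_deriv b \<phi>\<close> agrees with \<open>D b\<close> on \<Omega> but
  possibly not elsewhere. Hence the last premise speaks of every function that agrees with
  \<open>D b\<close> on \<Omega>; \<open>Ck_on_cong\<close> later reduces it to \<open>D b\<close>
  itself.\<close>

lemma Ck_on_SucI:
  assumes "open \<Omega>" "continuous_on \<Omega> \<phi>"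
    and D: "\<And>b z. b \<in> Basis \<Longrightarrow> z \<in> \<Omega> \<Longrightarrow>
      ((\<lambda>s. \<phi> (z + s *\<^sub>R b)) has_real_derivative D b z) (at 0)"
    and "\<And>b \<psi>. b \<in> Basis \<Longrightarrow> (\<And>z. z \<in> \<Omega> \<Longrightarrow> \<psi> z = D b z) \<Longrightarrow> Ck_on k \<Omega> \<psi>"
  shows "Ck_on (Suc k) \<Omega> \<phi>"
proof -
  have "dir_differentiable b \<phi> z \<and> dir_deriv b \<phi> z = D b z" if "b \<in> Basis" "z \<in> \<Omega>" for b z
    using D[OF that] by (auto intro: dir_derivI)
  then show ?thesis using assms by simp
qed

lemma Ck_on_cong:
  assumes "open \<Omega>" "\<And>z. z \<in> \<Omega> \<Longrightarrow> \<phi> z = \<psi> z" "Ck_on k \<Omega> \<phi>"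
  shows "Ck_on k \<Omega> \<psi>"
  using assms(2,3)
proof (induction k arbitrary: \<phi> \<psi>)
  case 0
  then show ?case using continuous_on_eq[of \<Omega> \<phi> \<psi>] by simp
next
  case (Suc k)
  have D: "dir_differentiable b \<phi> z" "Ck_on k \<Omega> (dir_deriv b \<phi>)" if "b \<in> Basis" "z \<in> \<Omega>" for b z
    using Suc.prems(2) that by auto
  have 1: "((\<lambda>s. \<psi> (z + s *\<^sub>R b)) has_real_derivative dir_deriv b \<phi> z) (at 0)"
    if "b \<in> Basis" "z \<in> \<Omega>" for b z
    by (rule line_has_derivative_cong[OF assms(1) that(2) Suc.prems(1) dir_derivD[OF D(1)[OF that]]])
  have 2: "dir_differentiable b \<psi> z" "dir_deriv b \<phi> z = dir_deriv b \<psi> z"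
    if "b \<in> Basis" "z \<in> \<Omega>" for b z
    using dir_derivI[OF 1[OF that]] by simp_all
  have 3: "Ck_on k \<Omega> (dir_deriv b \<psi>)" if b: "b \<in> Basis" for b
  proof (rule Suc.IH)
    show "Ck_on k \<Omega> (dir_deriv b \<phi>)" using Suc.prems(2) b by auto
    show "dir_deriv b \<phi> z = dir_deriv b \<psi> z" if "z \<in> \<Omega>" for z using 2(2)[OF b that] .
  qed
  have "continuous_on \<Omega> \<psi>"
    by (rule continuous_on_eq[of \<Omega> \<phi>]) (use Suc.prems in auto)
  then show ?case using 2(1) 3 by simp
qed

lemma Ck_on_SucI':
  assumes "open \<Omega>" "continuous_on \<Omega> \<phi>"
    and "\<And>b z. b \<in> Basis \<Longrightarrow> z \<in> \<Omega> \<Longrightarrow>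
      ((\<lambda>s. \<phi> (z + s *\<^sub>R b)) has_real_derivative D b z) (at 0)"
    and "\<And>b. b \<in> Basis \<Longrightarrow> Ck_on k \<Omega> (D b)"
  shows "Ck_on (Suc k) \<Omega> \<phi>"
proof (rule Ck_on_SucI[where D = D])
  show "Ck_on k \<Omega> \<psi>" if "b \<in> Basis" "\<And>z. z \<in> \<Omega> \<Longrightarrow> \<psi> z = D b z" for b \<psi>
    by (rule Ck_on_cong[OF assms(1) _ assms(4)[OF that(1)]]) (simp add: that)
  show "((\<lambda>s. \<phi> (z + s *\<^sub>R b)) has_real_derivative D b z) (at 0)" if "b \<in> Basis" "z \<in> \<Omega>" for b z
    by (rule assms(3)[OF that])
qed (fact assms(1) assms(2))+

lemma Ck_on_Suc_imp: "Ck_on (Suc k) \<Omega> \<phi> \<Longrightarrow> Ck_on k \<Omega> \<phi>"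
proof (induction k arbitrary: \<phi>)
  case (Suc k)
  have "Ck_on k \<Omega> (dir_deriv b \<phi>)" if "b \<in> Basis" for b
    by (rule Suc.IH) (use Suc.prems that in simp)
  then show ?case using Suc.prems by simp
qed simp

lemma Ck_on_continuous: "Ck_on k \<Omega> \<phi> \<Longrightarrow> continuous_on \<Omega> \<phi>"
  by (cases k) auto

lemma Ck_on_subset: "Ck_on k \<Omega> \<phi> \<Longrightarrow> \<Omega>' \<subseteq> \<Omega> \<Longrightarrow> Ck_on k \<Omega>' \<phi>"
  by (induction k arbitrary: \<phi>) (auto intro: continuous_on_subset)

lemma Ck_on_const:
  assumes "open \<Omega>"
  shows "Ck_on k \<Omega> (\<lambda>z. c)"
proof (induction k arbitrary: c)
  case (Suc k)
  show ?case by (rule Ck_on_SucI'[where D = "\<lambda>b z. 0"]) (use assms Suc in simp_all)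
qed simp

lemma Ck_on_add:
  assumes "open \<Omega>" "Ck_on k \<Omega> \<phi>" "Ck_on k \<Omega> \<psi>"
  shows "Ck_on k \<Omega> (\<lambda>z. \<phi> z + \<psi> z)"
  using assms(2,3)
proof (induction k arbitrary: \<phi> \<psi>)
  case (Suc k)
  show ?case
  proof (rule Ck_on_SucI'[where D = "\<lambda>b z. dir_deriv b \<phi> z + dir_deriv b \<psi> z"])
    show "((\<lambda>s. \<phi> (z + s *\<^sub>R b) + \<psi> (z + s *\<^sub>R b)) has_real_derivative
        dir_deriv b \<phi> z + dir_deriv b \<psi> z) (at 0)" if "b \<in> Basis" "z \<in> \<Omega>" for b z
      using DERIV_add[OF dir_derivD[of b \<phi> z] dir_derivD[of b \<psi> z]] Suc.prems that by simp
    show "Ck_on k \<Omega> (\<lambda>z. dir_deriv b \<phi> z + dir_deriv b \<psi> z)" if "b \<in> Basis" for b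
      by (rule Suc.IH) (use Suc.prems that in auto)
  qed (use Suc.prems assms(1) in \<open>auto intro: continuous_on_add\<close>)
qed (auto intro: continuous_on_add)

lemma Ck_on_mult:
  assumes "open \<Omega>" "Ck_on k \<Omega> \<phi>" "Ck_on k \<Omega> \<psi>"
  shows "Ck_on k \<Omega> (\<lambda>z. \<phi> z * \<psi> z)"
  using assms(2,3)
proof (induction k arbitrary: \<phi> \<psi>)
  case (Suc k)
  show ?case
  proof (rule Ck_on_SucI'[where D = "\<lambda>b z. dir_deriv b \<phi> z * \<psi> z + dir_deriv b \<psi> z * \<phi> z"])
    show "((\<lambda>s. \<phi> (z + s *\<^sub>R b) * \<psi> (z + s *\<^sub>R b)) has_real_derivative
        dir_deriv b \<phi> z * \<psi> z + dir_deriv b \<psi> z * \<phi> z) (at 0)" if "b \<in> Basis" "z \<in> \<Omega>" for b z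
      using DERIV_mult[OF dir_derivD[of b \<phi> z] dir_derivD[of b \<psi> z]] Suc.prems that by simp
    show "Ck_on k \<Omega> (\<lambda>z. dir_deriv b \<phi> z * \<psi> z + dir_deriv b \<psi> z * \<phi> z)" if "b \<in> Basis" for b
    proof (rule Ck_on_add[OF assms(1)])
      show "Ck_on k \<Omega> (\<lambda>z. dir_deriv b \<phi> z * \<psi> z)"
        by (rule Suc.IH) (use Suc.prems(1) Ck_on_Suc_imp[OF Suc.prems(2)] that in auto)
      show "Ck_on k \<Omega> (\<lambda>z. dir_deriv b \<psi> z * \<phi> z)"
        by (rule Suc.IH) (use Suc.prems(2) Ck_on_Suc_imp[OF Suc.prems(1)] that in auto)
    qed
  qed (use Suc.prems assms(1) in \<open>auto intro: continuous_on_mult\<close>)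
qed (auto intro: continuous_on_mult)

text \<open>The induction has to range over all \<open>F\<close>, since the chain rule replaces
  \<open>F\<close> by its derivative; the product with the derivative of \<open>w\<close> is left to
  \<open>Ck_on_mult\<close>.\<close>

lemma Ck_on_compose:
  fixes F :: "real \<Rightarrow> real"
  assumes "open \<Omega>" "Ck_on k \<Omega> w" "Ck_on k U F" "\<And>z. z \<in> \<Omega> \<Longrightarrow> w z \<in> U"
  shows "Ck_on k \<Omega> (\<lambda>z. F (w z))"
  using assms(2,3)
proof (induction k arbitrary: F)
  case 0
  then show ?case using assms(4) by (auto intro!: continuous_on_compose2[of U F])
next
  case (Suc k)
  \<comment> \<open>\<open>Basis\<close> of the reals is \<open>{1}\<close>, so
    \<open>dir_deriv 1 F\<close> is the ordinary derivative; the shift moves the base point from 0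
    to \<open>y\<close>.\<close>
  have dF: "(F has_real_derivative dir_deriv 1 F y) (at y)" if "y \<in> U" for y
    using dir_derivD[of 1 F y] Suc.prems that DERIV_shift[of F _ 0 y] by (simp add: add.commute)
  show ?case
  proof (rule Ck_on_SucI'[where D = "\<lambda>b z. dir_deriv 1 F (w z) * dir_deriv b w z"])
    show "continuous_on \<Omega> (\<lambda>z. F (w z))"
      using Suc.prems assms(4) by (auto intro!: continuous_on_compose2[of U F])
    show "((\<lambda>s. F (w (z + s *\<^sub>R b))) has_real_derivative
        dir_deriv 1 F (w z) * dir_deriv b w z) (at 0)" if "b \<in> Basis" "z \<in> \<Omega>" for b z
      using DERIV_chain2[of F "dir_deriv 1 F (w z)" "\<lambda>s. w (z + s *\<^sub>R b)" 0 "dir_deriv b w z" UNIV]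
        dF[of "w z"] assms(4)[OF that(2)] dir_derivD[of b w z] Suc.prems that by simp
    show "Ck_on k \<Omega> (\<lambda>z. dir_deriv 1 F (w z) * dir_deriv b w z)" if "b \<in> Basis" for b
    proof (rule Ck_on_mult[OF assms(1)])
      show "Ck_on k \<Omega> (\<lambda>z. dir_deriv 1 F (w z))"
        by (rule Suc.IH) (use Suc.prems Ck_on_Suc_imp[OF Suc.prems(1)] in auto)
      show "Ck_on k \<Omega> (dir_deriv b w)" using Suc.prems that by simp
    qed
  qed (fact assms)
qed

lemma Ck_on_inner:
  assumes "open \<Omega>"
  shows "Ck_on k \<Omega> (\<lambda>z. z \<bullet> v)"
proof (cases k)
  case (Suc k)
  have "Ck_on (Suc k) \<Omega> (\<lambda>z. z \<bullet> v)"
    by (rule Ck_on_SucI'[where D = "\<lambda>b z. b \<bullet> v"])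
      (auto intro!: continuous_intros derivative_eq_intros Ck_on_const assms simp: inner_add_left)
  then show ?thesis using Suc by simp
qed (auto intro: continuous_intros)

lemma Ck_on_sum:
  assumes "open \<Omega>" "\<And>i. i \<in> I \<Longrightarrow> Ck_on k \<Omega> (\<phi> i)"
  shows "Ck_on k \<Omega> (\<lambda>z. \<Sum>i\<in>I. \<phi> i z)"
  using assms(2)
  by (induction I rule: infinite_finite_induct) (auto intro: Ck_on_const Ck_on_add assms(1))

text \<open>The derivative is minus the square of the function itself, so the induction hypothesis
  and the product rule suffice.\<close>

lemma Ck_on_inverse: "Ck_on k {0<..} (inverse :: real \<Rightarrow> real)"
proof (induction k)
  case (Suc k)
  have "Ck_on k {0<..} (\<lambda>z::real. (- 1) * (inverse z * inverse z))"
    using Suc by (intro Ck_on_mult Ck_on_const) auto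
  then show ?case
    by (intro Ck_on_SucI'[where D = "\<lambda>b z. (- 1) * (inverse z * inverse z)"])
      (auto intro!: continuous_intros derivative_eq_intros)
qed (auto intro!: continuous_intros)

lemma Ck_on_ln: "Ck_on k {0<..} (ln :: real \<Rightarrow> real)"
proof (cases k)
  case (Suc k)
  have "Ck_on (Suc k) {0<..} (ln :: real \<Rightarrow> real)"
    by (intro Ck_on_SucI'[where D = "\<lambda>b. inverse"] Ck_on_inverse)
      (auto intro!: continuous_intros derivative_eq_intros simp: field_simps)
  then show ?thesis using Suc by simp
qed (auto intro!: continuous_intros)

section \<open>Smoothness on space-time and compact support\<close>

lemma time_dir_in_Basis: "time_dir \<in> Basis" and space_dir_in_Basis: "space_dir i \<in> Basis"
  unfolding time_dir_def space_dir_def Basis_prod_def by (auto simp: axis_in_Basis_iff)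

lemma smooth_on_imp_C12_on:
  assumes "smooth_on \<Omega> \<phi>"
  shows "C12_on \<Omega> \<phi>"
proof -
  have "Ck_on (Suc (Suc 0)) \<Omega> \<phi>" using assms unfolding smooth_on_def by blast
  then show ?thesis
    unfolding C12_on_def using time_dir_in_Basis space_dir_in_Basis by auto
qed

lemma dir_deriv_eq_0:
  fixes \<phi> :: "'a::euclidean_space \<Rightarrow> real"
  assumes "closed K" "\<And>z. z \<notin> K \<Longrightarrow> \<phi> z = 0" "z \<notin> K"
  shows "dir_deriv b \<phi> z = 0"
proof (rule dir_derivI(2))
  show "((\<lambda>s. \<phi> (z + s *\<^sub>R b)) has_real_derivative 0) (at 0)"
    by (rule line_has_derivative_cong[of "- K" z "\<lambda>_. 0"]) (use assms in auto)
qed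

lemma smooth_on_dir_deriv: "smooth_on \<Omega> \<phi> \<Longrightarrow> b \<in> Basis \<Longrightarrow> smooth_on \<Omega> (dir_deriv b \<phi>)"
  unfolding smooth_on_def using Ck_on.simps(2) by blast

lemma smooth_on_imp_continuous_on: "smooth_on \<Omega> \<phi> \<Longrightarrow> continuous_on \<Omega> \<phi>"
  unfolding smooth_on_def by (blast intro: Ck_on_continuous)

lemma smooth_on_subset: "smooth_on \<Omega> \<phi> \<Longrightarrow> \<Omega>' \<subseteq> \<Omega> \<Longrightarrow> smooth_on \<Omega>' \<phi>"
  unfolding smooth_on_def by (blast intro: Ck_on_subset)

lemma compactly_supported_inI:
  assumes "compact K" "K \<subseteq> \<Omega>" "\<And>z. z \<notin> K \<Longrightarrow> \<phi> z = 0"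
  shows "compactly_supported_in \<Omega> \<phi>"
proof -
  have "closure {z. \<phi> z \<noteq> 0} \<subseteq> K"
    using assms(3) by (intro closure_minimal compact_imp_closed[OF assms(1)]) auto
  moreover from this have "K \<inter> closure {z. \<phi> z \<noteq> 0} = closure {z. \<phi> z \<noteq> 0}" by blast
  ultimately show ?thesis
    unfolding compactly_supported_in_def
    using assms(2) compact_Int_closed[OF assms(1) closed_closure, of "{z. \<phi> z \<noteq> 0}"] by auto
qed

text \<open>The family \<open>flat P\<close> is closed under differentiation, and every member is bounded by any power
  \<open>\<kappa> < 1\<close> of \<open>flat 1\<close>, which is what Young's inequality needs in order to absorb
  derivatives of the cutoff.\<close>

definition flat :: "real poly \<Rightarrow> real \<Rightarrow> real" where
  "flat P s = (if s > 0 then poly P (1 / s) * exp (- 1 / s) else 0)"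

lemma poly_times_exp_tendsto_0: "((\<lambda>y::real. poly P y * exp (- (d * y))) \<longlongrightarrow> 0) at_top" if "d > 0"
proof -
  have "((\<lambda>y::real. y ^ k * exp (- (d * y))) \<longlongrightarrow> 0) at_top" for k
  proof -
    have "filterlim (\<lambda>y::real. d * y) at_top at_top"
      by (rule filterlim_tendsto_pos_mult_at_top[OF tendsto_const that filterlim_ident])
    from filterlim_compose[OF tendsto_power_div_exp_0[of k] this]
    have "((\<lambda>y. (d * y) ^ k / exp (d * y)) \<longlongrightarrow> 0) at_top" .
    from tendsto_mult_left[OF this, of "1 / d ^ k"] show ?thesis
      using that by (simp add: exp_minus field_simps)
  qed
  then have "((\<lambda>y::real. \<Sum>i\<le>degree P. coeff P i * (y ^ i * exp (- (d * y)))) \<longlongrightarrow>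
      (\<Sum>i\<le>degree P. coeff P i * 0)) at_top"
    by (intro tendsto_intros)
  then show ?thesis by (simp add: poly_altdef sum_distrib_right mult.assoc)
qed

text \<open>With y = 1/s, the derivative of P(1/s) exp(-1/s) in s is y^2 (P(y) - P'(y)) exp(-y); the
  factor \<open>[:0, 0, 1:]\<close> is y^2.\<close>

definition flat_step :: "real poly \<Rightarrow> real poly" where
  "flat_step P = [:0, 0, 1:] * (P - pderiv P)"

lemma flat_has_derivative: "(flat P has_real_derivative flat (flat_step P) s) (at s)"
proof -
  consider "s > 0" | "s < 0" | "s = 0" by linarith
  then show ?thesis
  proof cases
    case 1
    have "((\<lambda>s. poly P (1 / s) * exp (- 1 / s)) has_real_derivative flat (flat_step P) s) (at s)"
      using 1 by (auto intro!: derivative_eq_intros poly_DERIV[THEN DERIV_chain2]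
          simp: flat_def flat_step_def field_simps power2_eq_square)
    then show ?thesis
      by (rule has_field_derivative_transform_within_open[where S = "{0<..}"]) (use 1 in \<open>auto simp: flat_def\<close>)
  next
    case 2
    have "((\<lambda>s. 0) has_real_derivative flat (flat_step P) s) (at s)"
      using 2 by (simp add: flat_def)
    then show ?thesis
      by (rule has_field_derivative_transform_within_open[where S = "{..<0}"]) (use 2 in \<open>auto simp: flat_def\<close>)
  next
    case 3
    have "((\<lambda>h. flat P h / h) \<longlongrightarrow> 0) (at_right 0)"
    proof -
      \<comment> \<open>\<open>pCons 0 P\<close> is the polynomial y P(y); at y = 1/h its product
        with exp(-y) is the difference quotient of \<open>flat P\<close> at 0.\<close>
      have "((\<lambda>y. poly (pCons 0 P) y * exp (- (1 * y))) \<longlongrightarrow> 0) at_top"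
        by (rule poly_times_exp_tendsto_0) simp
      from filterlim_compose[OF this filterlim_inverse_at_top_right]
      have "((\<lambda>h. poly (pCons 0 P) (inverse h) * exp (- (1 * inverse h))) \<longlongrightarrow> 0) (at_right 0)" .
      then show ?thesis
        by (rule Lim_transform_eventually)
          (auto simp: eventually_at_filter flat_def field_simps)
    qed
    moreover have "((\<lambda>h. flat P h / h) \<longlongrightarrow> 0) (at_left 0)"
      by (rule tendsto_eventually) (auto simp: eventually_at_filter flat_def)
    ultimately have "((\<lambda>h. flat P h / h) \<longlongrightarrow> 0) (at 0)"
      by (simp add: filterlim_split_at)
    then show ?thesis using 3 by (simp add: DERIV_def flat_def)
  qed
qed

lemma Ck_on_flat: "Ck_on k UNIV (flat P)"
proof (induction k arbitrary: P)
  case 0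
  then show ?case
    by (auto intro!: DERIV_isCont[OF flat_has_derivative] continuous_at_imp_continuous_on)
next
  case (Suc k)
  show ?case
  proof (rule Ck_on_SucI'[where D = "\<lambda>b. flat (flat_step P)"])
    show "continuous_on UNIV (flat P)"
      by (auto intro!: DERIV_isCont[OF flat_has_derivative] continuous_at_imp_continuous_on)
    show "((\<lambda>s. flat P (z + s *\<^sub>R b)) has_real_derivative flat (flat_step P) z) (at 0)"
      if "b \<in> Basis" for b z
      using DERIV_shift[of "flat P" "flat (flat_step P) z" 0 z] flat_has_derivative[of P z] that
      by (simp add: add.commute)
  qed (use Suc in auto)
qed

text \<open>With y = 1/s, the quotient of the two sides is |P(y)| exp(-(1 - \<kappa>) y) up to the
  constant. It is continuous on y \<ge> 0 and tends to 0 at infinity, hence is bounded. For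
  \<open>s \<le> 0\<close> both sides are 0, because \<open>0 powr \<kappa> = 0\<close> for every
  \<kappa>.\<close>

lemma flat_bound:
  assumes "\<kappa> < 1"
  shows "\<exists>C>0. \<forall>s. \<bar>flat P s\<bar> \<le> C * flat 1 s powr \<kappa>"
proof -
  let ?g = "\<lambda>y::real. poly P y * exp (- ((1 - \<kappa>) * y))"
  have "(?g \<longlongrightarrow> 0) at_top" using assms by (intro poly_times_exp_tendsto_0) auto
  then have "eventually (\<lambda>y. dist (?g y) 0 < 1) at_top" by (rule tendstoD) simp
  then obtain N where N: "\<And>y. y \<ge> N \<Longrightarrow> \<bar>?g y\<bar> < 1"
    unfolding eventually_at_top_linorder by auto
  have "compact (?g ` {0..N})"
    by (intro compact_continuous_image continuous_intros) auto
  from compact_imp_bounded[OF this] obtain B where B: "\<And>y. y \<in> {0..N} \<Longrightarrow> \<bar>?g y\<bar> \<le> B"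
    unfolding bounded_iff by (metis (no_types, lifting) imageI real_norm_def)
  define C where "C = max B 1"
  have g: "\<bar>?g y\<bar> \<le> C" if "y \<ge> 0" for y
    using that N[of y] B[of y] unfolding C_def by (cases "y \<ge> N") auto
  have "\<bar>flat P s\<bar> \<le> C * flat 1 s powr \<kappa>" for s
  proof (cases "s > 0")
    case True
    have "\<bar>flat P s\<bar> = \<bar>?g (1 / s)\<bar> * exp (- (\<kappa> / s))"
      using True by (simp add: flat_def abs_mult mult.assoc exp_add[symmetric] field_simps)
    also have "\<dots> \<le> C * exp (- (\<kappa> / s))" using g[of "1 / s"] True by (intro mult_right_mono) auto
    also have "exp (- (\<kappa> / s)) = flat 1 s powr \<kappa>"
      using True by (simp add: flat_def powr_def)
    finally show ?thesis .
  qed (simp add: flat_def)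
  moreover have "C > 0" by (simp add: C_def)
  ultimately show ?thesis by blast
qed

lemma flat_1: "0 \<le> flat 1 s" "flat 1 s \<le> 1" "flat 1 s > 0 \<longleftrightarrow> s > 0"
  by (auto simp: flat_def)

section \<open>The logarithmic cutoff\<close>

definition time_arg :: "real \<Rightarrow> real \<Rightarrow> real" where
  "time_arg T t = 1 - (4 * t / T - 2)\<^sup>2"

text \<open>The summand 1 keeps the logarithm smooth at the origin. For \<open>L > 0\<close> the
  value is positive exactly where 1 + |x|^2 < e^L, which lies in the ball of radius e^(L/2).\<close>

definition space_arg :: "real \<Rightarrow> real ^ 'n \<Rightarrow> real" where
  "space_arg L x = 1 - ln (1 + x \<bullet> x) / L"

definition cutoff :: "real \<Rightarrow> real \<Rightarrow> real \<times> (real ^ 'n) \<Rightarrow> real" where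
  "cutoff L T z = flat 1 (time_arg T (fst z)) * flat 1 (space_arg L (snd z))"

lemma one_plus_inner_pos: "0 < 1 + x \<bullet> x" "1 + x \<bullet> x \<noteq> 0" for x :: "'a::real_inner"
  using inner_ge_zero[of x] by linarith+

text \<open>Both arguments are rewritten through linear forms of \<open>z\<close>, constants and
  \<open>ln\<close>, to which the closure rules for \<open>Ck_on\<close> apply; 1 + |x|^2 stays in
  \<open>{0<..}\<close>, where \<open>ln\<close> is smooth.\<close>

lemma smooth_cutoff: "smooth_on UNIV (cutoff L T :: real \<times> (real ^ 'n) \<Rightarrow> real)"
  unfolding smooth_on_def
proof
  fix k
  have "Ck_on k UNIV (\<lambda>z::real \<times> (real ^ 'n). 1 + (- 1) * ((4 / T * (z \<bullet> (1, 0)) + (- 2)) * (4 / T * (z \<bullet> (1, 0)) + (- 2))))"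
    by (intro Ck_on_add Ck_on_mult Ck_on_const Ck_on_inner open_UNIV)
  moreover have "(\<lambda>z::real \<times> (real ^ 'n). 1 + (- 1) * ((4 / T * (z \<bullet> (1, 0)) + (- 2)) * (4 / T * (z \<bullet> (1, 0)) + (- 2))))
      = (\<lambda>z. time_arg T (fst z))"
    by (auto simp: time_arg_def inner_prod_def power2_eq_square)
  ultimately have t: "Ck_on k UNIV (\<lambda>z::real \<times> (real ^ 'n). time_arg T (fst z))" by simp
  have "Ck_on k UNIV (\<lambda>z::real \<times> (real ^ 'n). 1 + (\<Sum>b\<in>Basis. (z \<bullet> (0, b)) * (z \<bullet> (0, b))))"
    by (intro Ck_on_add Ck_on_sum Ck_on_mult Ck_on_const Ck_on_inner open_UNIV)
  moreover have "(\<lambda>z::real \<times> (real ^ 'n). 1 + (\<Sum>b\<in>Basis. (z \<bullet> (0, b)) * (z \<bullet> (0, b))))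
      = (\<lambda>z. 1 + snd z \<bullet> snd z)"
    by (auto simp: inner_prod_def euclidean_inner[of "snd _" "snd _"])
  ultimately have "Ck_on k UNIV (\<lambda>z::real \<times> (real ^ 'n). 1 + snd z \<bullet> snd z)" by simp
  then have "Ck_on k UNIV (\<lambda>z::real \<times> (real ^ 'n). ln (1 + snd z \<bullet> snd z))"
    by (intro Ck_on_compose[OF open_UNIV _ Ck_on_ln]) (auto simp: one_plus_inner_pos)
  then have "Ck_on k UNIV (\<lambda>z::real \<times> (real ^ 'n). 1 + (- 1 / L) * ln (1 + snd z \<bullet> snd z))"
    by (intro Ck_on_add Ck_on_mult Ck_on_const open_UNIV)
  then have x: "Ck_on k UNIV (\<lambda>z::real \<times> (real ^ 'n). space_arg L (snd z))"
    by (simp add: space_arg_def)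
  have "Ck_on k UNIV (\<lambda>z::real \<times> (real ^ 'n). flat 1 (time_arg T (fst z)) * flat 1 (space_arg L (snd z)))"
    by (intro Ck_on_mult open_UNIV Ck_on_compose[OF open_UNIV t Ck_on_flat]
        Ck_on_compose[OF open_UNIV x Ck_on_flat]) auto
  then show "Ck_on k UNIV (cutoff L T :: real \<times> (real ^ 'n) \<Rightarrow> real)"
    by (simp add: cutoff_def[abs_def])
qed

lemma cutoff_nonneg: "0 \<le> cutoff L T z"
  unfolding cutoff_def by (auto intro!: mult_nonneg_nonneg flat_1)

lemma cutoff_support:
  assumes "cutoff L T z \<noteq> 0" "L > 0" "T > 0"
  shows "fst z \<in> {T / 4..3 * T / 4}" "ln (1 + snd z \<bullet> snd z) < L" "snd z \<in> cball 0 (exp (L / 2))"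
proof -
  have "time_arg T (fst z) > 0" "space_arg L (snd z) > 0"
    using assms(1) flat_1(1,3)[of "time_arg T (fst z)"] flat_1(1,3)[of "space_arg L (snd z)"]
    unfolding cutoff_def by (auto simp: order_less_le)
  then have "\<bar>4 * fst z / T - 2\<bar> < 1" "ln (1 + snd z \<bullet> snd z) / L < 1"
    by (auto simp: time_arg_def space_arg_def abs_square_less_1)
  then show "fst z \<in> {T / 4..3 * T / 4}" and l: "ln (1 + snd z \<bullet> snd z) < L"
    using assms by (auto simp: abs_less_iff field_simps)
  have "exp (ln (1 + snd z \<bullet> snd z)) < exp L" using l by simp
  then have "snd z \<bullet> snd z \<le> exp L" using one_plus_inner_pos[of "snd z"] by simp
  moreover have "(exp (L / 2))\<^sup>2 = exp L" by (simp add: power2_eq_square exp_add[symmetric])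
  ultimately have "(norm (snd z))\<^sup>2 \<le> (exp (L / 2))\<^sup>2" by (simp add: power2_norm_eq_inner)
  then have "norm (snd z) \<le> exp (L / 2)" by (rule power2_le_imp_le) simp
  then show "snd z \<in> cball 0 (exp (L / 2))" by simp
qed

section \<open>Derivatives of the cutoff and their bounds\<close>

lemma time_arg_has_derivative:
  "(time_arg T has_real_derivative - 2 * (4 * t / T - 2) * (4 / T)) (at t)"
proof -
  have "((\<lambda>t. 1 - (c * t - 2)\<^sup>2) has_real_derivative - 2 * (c * t - 2) * c) (at t)" for c :: real
    by (auto intro!: derivative_eq_intros simp: algebra_simps)
  from this[of "4 / T"] show ?thesis by (simp add: time_arg_def[abs_def])
qed

lemma inner_add_axis:
  "(x + s *\<^sub>R axis i 1) \<bullet> (x + s *\<^sub>R axis i 1) = x \<bullet> x + 2 * s * x $ i + s\<^sup>2" for x :: "real ^ 'n"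
  by (simp add: inner_add_left inner_add_right inner_axis inner_axis' inner_commute power2_eq_square
      inner_axis_axis algebra_simps)

definition space_arg_deriv :: "real \<Rightarrow> 'n::finite \<Rightarrow> real ^ 'n \<Rightarrow> real" where
  "space_arg_deriv L i x = - (2 * x $ i) / (L * (1 + x \<bullet> x))"

definition space_arg_deriv2 :: "real \<Rightarrow> 'n::finite \<Rightarrow> real ^ 'n \<Rightarrow> real" where
  "space_arg_deriv2 L i x = - 2 * ((1 + x \<bullet> x) - 2 * (x $ i)\<^sup>2) / (L * (1 + x \<bullet> x)\<^sup>2)"

lemma space_arg_line_derivative:
  assumes "L > 0"
  shows "((\<lambda>s. space_arg L (x + s *\<^sub>R axis i 1)) has_real_derivative space_arg_deriv L i x) (at 0)"
    and "((\<lambda>s. space_arg_deriv L i (x + s *\<^sub>R axis i 1)) has_real_derivative space_arg_deriv2 L i x) (at 0)"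
proof -
  \<comment> \<open>\<open>q s\<close> is 1 + |x + s e_i|^2 expanded as a polynomial in
    \<open>s\<close>, which leaves one-variable calculus.\<close>
  define q where "q s = 1 + (x \<bullet> x + 2 * s * x $ i + s\<^sup>2)" for s
  define r where "r = 1 + x \<bullet> x"
  have r: "r > 0" and q0: "q 0 = r" using one_plus_inner_pos[of x] by (auto simp: r_def q_def)
  have q: "(q has_real_derivative 2 * x $ i) (at 0)"
    unfolding q_def[abs_def] by (auto intro!: derivative_eq_intros)
  have "((\<lambda>s. 1 - ln (q s) / L) has_real_derivative - (2 * x $ i) / (L * r)) (at 0)"
    using r assms by (auto intro!: derivative_eq_intros q simp: q0 field_simps)
  then show "((\<lambda>s. space_arg L (x + s *\<^sub>R axis i 1)) has_real_derivative space_arg_deriv L i x) (at 0)"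
    unfolding space_arg_def space_arg_deriv_def inner_add_axis q_def r_def by simp
  have "((\<lambda>s. - (2 * (x $ i + s)) / (L * q s)) has_real_derivative
      - 2 * (r - 2 * (x $ i)\<^sup>2) / (L * r\<^sup>2)) (at 0)"
    using r assms by (auto intro!: derivative_eq_intros q simp: q0 field_simps power2_eq_square)
  then show "((\<lambda>s. space_arg_deriv L i (x + s *\<^sub>R axis i 1)) has_real_derivative space_arg_deriv2 L i x) (at 0)"
    unfolding space_arg_deriv_def space_arg_deriv2_def inner_add_axis q_def r_def by (simp add: axis_def)
qed

lemma cutoff_line_derivatives:
  fixes z :: "real \<times> (real ^ 'n)"
  assumes "L > 0"
  shows "dir_deriv time_dir (cutoff L T) z =
      flat (flat_step 1) (time_arg T (fst z)) * (- 2 * (4 * fst z / T - 2) * (4 / T)) * flat 1 (space_arg L (snd z))"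
    and "dir_deriv (space_dir i) (cutoff L T) z =
      flat 1 (time_arg T (fst z)) * (flat (flat_step 1) (space_arg L (snd z)) * space_arg_deriv L i (snd z))"
    and "dir_deriv (space_dir i) (dir_deriv (space_dir i) (cutoff L T)) z =
      flat 1 (time_arg T (fst z)) *
        (flat (flat_step (flat_step 1)) (space_arg L (snd z)) * (space_arg_deriv L i (snd z))\<^sup>2 +
         flat (flat_step 1) (space_arg L (snd z)) * space_arg_deriv2 L i (snd z))"
proof -
  have "((\<lambda>t. flat 1 (time_arg T t)) has_real_derivative
      flat (flat_step 1) (time_arg T (fst z)) * (- 2 * (4 * fst z / T - 2) * (4 / T))) (at (fst z))"
    by (rule DERIV_chain2[OF flat_has_derivative time_arg_has_derivative])
  then have t: "((\<lambda>s. flat 1 (time_arg T (fst z + s))) has_real_derivative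
      flat (flat_step 1) (time_arg T (fst z)) * (- 2 * (4 * fst z / T - 2) * (4 / T))) (at 0)"
    using DERIV_shift[of "\<lambda>t. flat 1 (time_arg T t)" _ 0 "fst z"] by (simp add: add.commute)
  show "dir_deriv time_dir (cutoff L T) z =
      flat (flat_step 1) (time_arg T (fst z)) * (- 2 * (4 * fst z / T - 2) * (4 / T)) * flat 1 (space_arg L (snd z))"
    using dir_derivI(2)[of "cutoff L T" z time_dir] DERIV_cmult_right[OF t, of "flat 1 (space_arg L (snd z))"]
    by (simp add: cutoff_def time_dir_def)
  have x: "((\<lambda>s. flat P (space_arg L (x + s *\<^sub>R axis i 1))) has_real_derivative
      flat (flat_step P) (space_arg L x) * space_arg_deriv L i x) (at 0)" for P and x :: "real ^ 'n" and i
    using DERIV_chain2[OF flat_has_derivative space_arg_line_derivative(1)[OF assms]] by fastforce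
  \<comment> \<open>Stated for every \<open>z\<close>: the second derivative needs this formula
    along the whole line, not only at the base point.\<close>
  have d1: "dir_deriv (space_dir i) (cutoff L T) z =
      flat 1 (time_arg T (fst z)) * (flat (flat_step 1) (space_arg L (snd z)) * space_arg_deriv L i (snd z))"
    for i and z :: "real \<times> (real ^ 'n)"
    using dir_derivI(2)[of "cutoff L T" z "space_dir i"]
      DERIV_cmult[OF x[of 1 "snd z" i], of "flat 1 (time_arg T (fst z))"]
    by (simp add: cutoff_def space_dir_def)
  then show "dir_deriv (space_dir i) (cutoff L T) z =
      flat 1 (time_arg T (fst z)) * (flat (flat_step 1) (space_arg L (snd z)) * space_arg_deriv L i (snd z))" .
  have "((\<lambda>s. flat (flat_step 1) (space_arg L (snd z + s *\<^sub>R axis i 1)) * space_arg_deriv L i (snd z + s *\<^sub>R axis i 1))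
      has_real_derivative
      (flat (flat_step (flat_step 1)) (space_arg L (snd z)) * (space_arg_deriv L i (snd z))\<^sup>2 +
         flat (flat_step 1) (space_arg L (snd z)) * space_arg_deriv2 L i (snd z))) (at 0)"
    using DERIV_mult[OF x[of "flat_step 1" "snd z" i] space_arg_line_derivative(2)[OF assms, of i "snd z"]]
    by (simp add: power2_eq_square algebra_simps)
  from DERIV_cmult[OF this, of "flat 1 (time_arg T (fst z))"]
  show "dir_deriv (space_dir i) (dir_deriv (space_dir i) (cutoff L T)) z =
      flat 1 (time_arg T (fst z)) *
        (flat (flat_step (flat_step 1)) (space_arg L (snd z)) * (space_arg_deriv L i (snd z))\<^sup>2 +
         flat (flat_step 1) (space_arg L (snd z)) * space_arg_deriv2 L i (snd z))"
    by (intro dir_derivI(2), unfold d1) (simp add: space_dir_def)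
qed

text \<open>All three follow from x_i^2 \<le> 1 + |x|^2. In the second, \<open>L \<ge> 1\<close>
  weakens 1/L^2 to 1/L, so that both terms of the Laplacian of the cutoff get the same
  weight.\<close>

lemma space_arg_deriv_bounds:
  fixes x :: "real ^ 'n"
  assumes "L \<ge> 1"
  shows "\<bar>space_arg_deriv L i x\<bar> \<le> 2 / (L * sqrt (1 + x \<bullet> x))"
    and "(space_arg_deriv L i x)\<^sup>2 \<le> 4 / (L * (1 + x \<bullet> x))"
    and "\<bar>space_arg_deriv2 L i x\<bar> \<le> 6 / (L * (1 + x \<bullet> x))"
proof -
  define r where "r = 1 + x \<bullet> x"
  have r: "r > 0" using one_plus_inner_pos[of x] by (simp add: r_def)
  have xr: "(x $ i)\<^sup>2 \<le> r"
  proof -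
    have "(x $ i)\<^sup>2 \<le> (norm x)\<^sup>2"
      using power_mono[OF component_le_norm_cart[of x i], of 2] by simp
    then show ?thesis by (simp add: r_def power2_norm_eq_inner)
  qed
  then have xs: "\<bar>x $ i\<bar> \<le> sqrt r" by (simp add: real_le_rsqrt)
  have "\<bar>space_arg_deriv L i x\<bar> = 2 * \<bar>x $ i\<bar> / (L * r)"
    using assms r by (simp add: space_arg_deriv_def r_def[symmetric] abs_mult)
  also have "\<dots> \<le> 2 * sqrt r / (L * r)"
    using assms r xs by (intro divide_right_mono) auto
  also have "\<dots> = 2 / (L * sqrt r)"
    using r assms by (simp add: field_simps)
  finally show 1: "\<bar>space_arg_deriv L i x\<bar> \<le> 2 / (L * sqrt (1 + x \<bullet> x))" by (simp add: r_def)
  have "(space_arg_deriv L i x)\<^sup>2 \<le> (2 / (L * sqrt r))\<^sup>2"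
    using power_mono[OF 1, of 2] by (simp add: r_def)
  also have "\<dots> = 4 / (L * r) / L" using r by (simp add: power_divide power_mult_distrib power2_eq_square)
  also have "\<dots> \<le> 4 / (L * r)" using assms r by (simp add: divide_le_eq)
  finally show "(space_arg_deriv L i x)\<^sup>2 \<le> 4 / (L * (1 + x \<bullet> x))" by (simp add: r_def)
  have "\<bar>space_arg_deriv2 L i x\<bar> = 2 * \<bar>r - 2 * (x $ i)\<^sup>2\<bar> / (L * r\<^sup>2)"
    unfolding space_arg_deriv2_def r_def[symmetric] abs_divide abs_mult using assms r by simp
  also have "\<dots> \<le> 2 * (3 * r) / (L * r\<^sup>2)"
  proof (intro divide_right_mono mult_left_mono)
    show "\<bar>r - 2 * (x $ i)\<^sup>2\<bar> \<le> 3 * r" using r xr zero_le_power2[of "x $ i"] by linarith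
  qed (use assms in auto)
  also have "\<dots> = 6 / (L * r)" using r by (simp add: power2_eq_square)
  finally show "\<bar>space_arg_deriv2 L i x\<bar> \<le> 6 / (L * (1 + x \<bullet> x))" by (simp add: r_def)
qed

text \<open>Holds because \<open>flat 1\<close> takes values in [0, 1]. It supplies the power
  \<kappa> of the factor that is not differentiated.\<close>

lemma flat_1_le_powr: "0 \<le> \<kappa> \<Longrightarrow> \<kappa> \<le> 1 \<Longrightarrow> flat 1 s \<le> flat 1 s powr \<kappa>"
  using powr_mono'[of \<kappa> 1 "flat 1 s"] flat_1[of s] by simp

text \<open>The differentiated factor is bounded by \<open>flat_bound\<close> and the other one by
  \<open>flat_1_le_powr\<close>, so their product carries the power \<kappa> of the whole cutoff.
  \<open>C\<close> is uniform in \<open>L\<close>, \<open>T\<close> and \<open>z\<close>, since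
  \<open>L\<close> and \<open>T\<close> will tend to infinity.\<close>

lemma cutoff_derivative_bounds:
  assumes "0 \<le> \<kappa>" "\<kappa> < 1"
  shows "\<exists>C>0. \<forall>L\<ge>1. \<forall>T>0. \<forall>z :: real \<times> (real ^ 'n).
    \<bar>dir_deriv time_dir (cutoff L T) z\<bar> \<le> C * (1 / T) * cutoff L T z powr \<kappa> \<and>
    \<bar>space_laplacian (cutoff L T) z\<bar> \<le> C * (1 / (L * (1 + snd z \<bullet> snd z))) * cutoff L T z powr \<kappa> \<and>
    (\<Sum>i\<in>UNIV. \<bar>dir_deriv (space_dir i) (cutoff L T) z\<bar>)
      \<le> C * (1 / (L * sqrt (1 + snd z \<bullet> snd z))) * cutoff L T z powr \<kappa>"
proof -
  obtain C1 where C1: "C1 > 0" "\<And>s. \<bar>flat (flat_step 1) s\<bar> \<le> C1 * flat 1 s powr \<kappa>"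
    using flat_bound[OF assms(2)] by blast
  obtain C2 where C2: "C2 > 0" "\<And>s. \<bar>flat (flat_step (flat_step 1)) s\<bar> \<le> C2 * flat 1 s powr \<kappa>"
    using flat_bound[OF assms(2)] by blast
  define n where "n = real CARD('n)"
  have n: "n > 0" by (simp add: n_def)
  \<comment> \<open>8 comes from the inner derivative of \<open>time_arg\<close>; 4, 6 and 2 are the
    constants in \<open>space_arg_deriv_bounds\<close>; \<open>n\<close> counts the directions. The
    sum serves all three bounds at once.\<close>
  define C where "C = C1 * 8 + n * (C2 * 4 + C1 * 6) + n * (2 * C1)"
  have Cpos: "C > 0" using C1 C2 n by (simp add: C_def add_pos_pos)
  have main: "\<bar>dir_deriv time_dir (cutoff L T) z\<bar> \<le> C * (1 / T) * cutoff L T z powr \<kappa> \<and>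
    \<bar>space_laplacian (cutoff L T) z\<bar> \<le> C * (1 / (L * (1 + snd z \<bullet> snd z))) * cutoff L T z powr \<kappa> \<and>
    (\<Sum>i\<in>UNIV. \<bar>dir_deriv (space_dir i) (cutoff L T) z\<bar>)
      \<le> C * (1 / (L * sqrt (1 + snd z \<bullet> snd z))) * cutoff L T z powr \<kappa>"
    if L: "L \<ge> 1" and T: "T > 0" for L T and z :: "real \<times> (real ^ 'n)"
  proof -
    define a x A W where "a = time_arg T (fst z)" and "x = snd z"
      and "A = flat 1 a powr \<kappa>" and "W = flat 1 (space_arg L x) powr \<kappa>"
    have L0: "L > 0" using L by simp
    have AW: "cutoff L T z powr \<kappa> = A * W"
      unfolding cutoff_def A_def W_def a_def x_def by (intro powr_mult)
    have A: "flat 1 a \<le> A" "A \<ge> 0" and W: "flat 1 (space_arg L x) \<le> W" "W \<ge> 0"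
      using flat_1_le_powr[of \<kappa>] assms by (auto simp: A_def W_def)
    define r where "r = 1 + x \<bullet> x"
    have r: "r > 0" using one_plus_inner_pos[of x] by (simp add: r_def)
    \<comment> \<open>Where the parabola is positive, |4t/T - 2| \<le> 1 and the inner derivative is
      at most 8/T; elsewhere the \<open>flat\<close> factor is 0.\<close>
    have t: "\<bar>flat (flat_step 1) a * (- 2 * (4 * fst z / T - 2) * (4 / T))\<bar> \<le> C1 * A * (8 / T)"
    proof (cases "a > 0")
      case True
      then have "\<bar>4 * fst z / T - 2\<bar> \<le> 1"
        by (auto simp: a_def time_arg_def abs_square_less_1 less_imp_le)
      then have "\<bar>- 2 * (4 * fst z / T - 2) * (4 / T)\<bar> \<le> 8 / T"
        using T by (simp add: abs_mult divide_right_mono)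
      then show ?thesis
        unfolding abs_mult[of "flat _ _"] using C1(2)[of a] C1(1) A by (intro mult_mono) (auto simp: A_def)
    next
      case False
      then show ?thesis using C1 A T by (simp add: flat_def)
    qed
    have "\<bar>dir_deriv time_dir (cutoff L T) z\<bar> \<le> C1 * A * (8 / T) * W"
      unfolding cutoff_line_derivatives(1)[OF L0] abs_mult[of _ "flat 1 _"] a_def[symmetric] x_def[symmetric]
      using t W flat_1(1)[of "space_arg L x"] C1(1) A(2) T by (intro mult_mono) auto
    also have "\<dots> = C1 * 8 * ((1 / T) * (A * W))" by simp
    also have "\<dots> \<le> C * ((1 / T) * (A * W))"
      using T A W C1 C2 n by (intro mult_right_mono) (auto simp: C_def)
    finally have 1: "\<bar>dir_deriv time_dir (cutoff L T) z\<bar> \<le> C * (1 / T) * (A * W)" by (simp add: mult.assoc)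
    have "\<bar>dir_deriv (space_dir i) (cutoff L T) z\<bar> \<le> A * (C1 * W * (2 / (L * sqrt r)))" for i
      unfolding cutoff_line_derivatives(2)[OF L0] abs_mult a_def[symmetric] x_def[symmetric]
      using A C1(2)[of "space_arg L x"] space_arg_deriv_bounds(1)[OF L, of i x] C1(1) W flat_1(1)[of a]
      by (intro mult_mono) (auto simp: W_def r_def)
    then have "(\<Sum>i\<in>(UNIV::'n set). \<bar>dir_deriv (space_dir i) (cutoff L T) z\<bar>)
        \<le> (\<Sum>i\<in>(UNIV::'n set). A * (C1 * W * (2 / (L * sqrt r))))"
      by (intro sum_mono)
    also have "\<dots> = n * (2 * C1) * ((1 / (L * sqrt r)) * (A * W))" by (simp add: n_def)
    also have "\<dots> \<le> C * ((1 / (L * sqrt r)) * (A * W))"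
      using L r A W C1 C2 n by (intro mult_right_mono) (auto simp: C_def)
    finally have 2: "(\<Sum>i\<in>(UNIV::'n set). \<bar>dir_deriv (space_dir i) (cutoff L T) z\<bar>)
        \<le> C * (1 / (L * sqrt r)) * (A * W)" by (simp add: mult.assoc)
    have "\<bar>dir_deriv (space_dir i) (dir_deriv (space_dir i) (cutoff L T)) z\<bar>
        \<le> A * (C2 * W * (4 / (L * r)) + C1 * W * (6 / (L * r)))" for i
    proof -
      have "\<bar>flat (flat_step (flat_step 1)) (space_arg L x) * (space_arg_deriv L i x)\<^sup>2 +
         flat (flat_step 1) (space_arg L x) * space_arg_deriv2 L i x\<bar>
         \<le> \<bar>flat (flat_step (flat_step 1)) (space_arg L x)\<bar> * (space_arg_deriv L i x)\<^sup>2 +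
         \<bar>flat (flat_step 1) (space_arg L x)\<bar> * \<bar>space_arg_deriv2 L i x\<bar>"
        by (rule order_trans[OF abs_triangle_ineq]) (simp add: abs_mult)
      also have "\<dots> \<le> C2 * W * (4 / (L * r)) + C1 * W * (6 / (L * r))"
        using C1(2)[of "space_arg L x"] C2(2)[of "space_arg L x"] C1(1) C2(1) W
          space_arg_deriv_bounds(2,3)[OF L, of i x]
        by (intro add_mono mult_mono) (auto simp: W_def r_def)
      finally show ?thesis
        unfolding cutoff_line_derivatives(3)[OF L0] abs_mult a_def[symmetric] x_def[symmetric]
        using A flat_1(1)[of a] by (intro mult_mono) auto
    qed
    then have "(\<Sum>i\<in>(UNIV::'n set). \<bar>dir_deriv (space_dir i) (dir_deriv (space_dir i) (cutoff L T)) z\<bar>)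
        \<le> (\<Sum>i\<in>(UNIV::'n set). A * (C2 * W * (4 / (L * r)) + C1 * W * (6 / (L * r))))"
      by (intro sum_mono)
    then have "\<bar>space_laplacian (cutoff L T) z\<bar>
        \<le> (\<Sum>i\<in>(UNIV::'n set). A * (C2 * W * (4 / (L * r)) + C1 * W * (6 / (L * r))))"
      unfolding space_laplacian_def by (rule order_trans[OF sum_abs])
    also have "\<dots> = n * (C2 * 4 + C1 * 6) * ((1 / (L * r)) * (A * W))"
      by (simp add: n_def algebra_simps add_divide_distrib)
    also have "\<dots> \<le> C * ((1 / (L * r)) * (A * W))"
      using L r A W C1 C2 n by (intro mult_right_mono) (auto simp: C_def)
    finally have 3: "\<bar>space_laplacian (cutoff L T) z\<bar> \<le> C * (1 / (L * r)) * (A * W)" by (simp add: mult.assoc)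
    show ?thesis using 1 2 3 unfolding AW r_def x_def by blast
  qed
  show ?thesis using Cpos main by blast
qed

section \<open>The cutoff as an admissible test function\<close>

definition slab :: "real \<Rightarrow> real \<Rightarrow> (real \<times> (real ^ 'n)) set" where
  "slab T R = {T / 4..3 * T / 4} \<times> cball 0 R"

lemma slab_props:
  fixes T L :: real
  assumes "T > 0"
  shows "compact (slab T (exp (L / 2)) :: (real \<times> (real ^ 'n)) set)"
    and "slab T (exp (L / 2)) \<subseteq> (cylinder T :: (real \<times> (real ^ 'n)) set)"
  using assms by (auto simp: slab_def cylinder_def intro: compact_Times)

lemma cutoff_derivatives_eq_0:
  fixes z :: "real \<times> (real ^ 'n)"
  assumes "L > 0" "T > 0" "z \<notin> slab T (exp (L / 2))"
  shows "cutoff L T z = 0" "dir_deriv time_dir (cutoff L T) z = 0"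
    "dir_deriv (space_dir i) (cutoff L T) z = 0"
    "dir_deriv (space_dir i) (dir_deriv (space_dir i) (cutoff L T)) z = 0"
    "space_laplacian (cutoff L T) z = 0"
proof -
  note K = compact_imp_closed[OF slab_props(1)[OF assms(2), of L, where 'n = 'n]]
  have 0: "cutoff L T z = 0" if "z \<notin> slab T (exp (L / 2))" for z :: "real \<times> (real ^ 'n)"
    using cutoff_support[OF _ assms(1,2), of z] that by (force simp: slab_def mem_Times_iff)
  have 1: "dir_deriv b (cutoff L T) z = 0" if "z \<notin> slab T (exp (L / 2))" for b and z :: "real \<times> (real ^ 'n)"
    by (rule dir_deriv_eq_0[OF K 0 that])
  have 2: "dir_deriv c (dir_deriv b (cutoff L T)) z = 0" if "z \<notin> slab T (exp (L / 2))" for b c and z :: "real \<times> (real ^ 'n)"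
    by (rule dir_deriv_eq_0[OF K 1 that])
  show "cutoff L T z = 0" "dir_deriv time_dir (cutoff L T) z = 0"
    "dir_deriv (space_dir i) (cutoff L T) z = 0"
    "dir_deriv (space_dir i) (dir_deriv (space_dir i) (cutoff L T)) z = 0"
    "space_laplacian (cutoff L T) z = 0"
    using 0 1 2 assms(3) by (auto simp: space_laplacian_def)
qed

lemma cutoff_test_function:
  assumes "L > 0" "T > 0"
  shows "test_function T (cutoff L T :: real \<times> (real ^ 'n) \<Rightarrow> real)"
proof -
  have "compactly_supported_in (cylinder T) (cutoff L T :: real \<times> (real ^ 'n) \<Rightarrow> real)"
    by (rule compactly_supported_inI[OF slab_props[OF assms(2), of L] cutoff_derivatives_eq_0(1)[OF assms]])
  moreover have "C12_on (cylinder T) (cutoff L T :: real \<times> (real ^ 'n) \<Rightarrow> real)"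
    using smooth_on_imp_C12_on[OF smooth_on_subset[OF smooth_cutoff[of L T]]] by blast
  ultimately show ?thesis
    unfolding test_function_def using cutoff_nonneg by blast
qed

section \<open>The limit of large space and time scales\<close>

text \<open>The product is split as (d U V^(1/p)) times (C/d) \<sigma>. The choice d = (\<epsilon>
  p)^(1/p) makes the first Young term exactly \<epsilon> V U^p; the price 1/d goes into
  \<open>K\<close>.\<close>

lemma Youngs_inequality_weighted:
  fixes p \<epsilon> C :: real
  assumes "p > 1" "\<epsilon> > 0" "C \<ge> 0"
  shows "\<exists>K>0. \<forall>U\<ge>0. \<forall>V\<ge>0. \<forall>\<sigma>\<ge>0.
    U * (C * \<sigma> * V powr (1 / p)) \<le> \<epsilon> * (V * U powr p) + K * \<sigma> powr (p / (p - 1))"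
proof -
  define q where "q = p / (p - 1)"
  have q: "q > 1" "1 / p + 1 / q = 1" using assms by (auto simp: q_def field_simps)
  define d where "d = (\<epsilon> * p) powr (1 / p)"
  have d: "d > 0" using assms by (simp add: d_def)
  \<comment> \<open>The added 1 makes \<open>K\<close> positive even for
    \<open>C = 0\<close>.\<close>
  define K where "K = (C / d) powr q / q + 1"
  have "U * (C * \<sigma> * V powr (1 / p)) \<le> \<epsilon> * (V * U powr p) + K * \<sigma> powr q"
    if "U \<ge> 0" "V \<ge> 0" "\<sigma> \<ge> 0" for U V \<sigma>
  proof -
    have "U * (C * \<sigma> * V powr (1 / p)) = (d * U * V powr (1 / p)) * ((C / d) * \<sigma>)"
      using d by simp
    also have "\<dots> \<le> (d * U * V powr (1 / p)) powr p / p + ((C / d) * \<sigma>) powr q / q"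
      using assms q d that by (intro Youngs_inequality) auto
    also have "(d * U * V powr (1 / p)) powr p = (\<epsilon> * p) * U powr p * V"
      using assms that by (simp add: powr_mult powr_powr d_def)
    also have "((C / d) * \<sigma>) powr q = (C / d) powr q * \<sigma> powr q"
      by (rule powr_mult)
    also have "(\<epsilon> * p) * U powr p * V / p + (C / d) powr q * \<sigma> powr q / q \<le> \<epsilon> * (V * U powr p) + K * \<sigma> powr q"
      using assms by (simp add: K_def algebra_simps)
    finally show ?thesis .
  qed
  moreover have "K > 0" using q by (simp add: K_def add_nonneg_pos)
  ultimately show ?thesis unfolding q_def by blast
qed

text \<open>On the support of the cutoff, the critical weight \<open>(1 + |x|\<^sup>2)\<^bsup>-n/2\<^esup>\<close> is dominated by
  balls of radius \<open>e\<^bsup>(k+1)/2\<^esup>\<close>, each contributing a bounded amount of mass.\<close>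

definition shells :: "nat \<Rightarrow> real \<Rightarrow> real \<Rightarrow> real \<Rightarrow> real \<times> (real ^ 'n) \<Rightarrow> real" where
  "shells N T a b z =
     real N powr (- a) * (\<Sum>k<N. exp (- (real k * real CARD('n) / 2)) *
       indicator (slab T (exp (real (Suc k) / 2))) z) +
     T powr (- b) * indicator (slab T (exp (real N / 2))) z"

text \<open>A single term of the sum suffices. With r = 1 + |x|^2 and k the integer part of ln r,
  the point lies in the ball of radius e^((k+1)/2), while r^(-n/2) \<le> e^(-kn/2).\<close>

lemma weight_le_shells:
  fixes z :: "real \<times> (real ^ 'n)"
  assumes "cutoff (real N) T z \<noteq> 0" "N \<ge> 1" "T > 0"
  shows "real N powr (- a) * (1 + snd z \<bullet> snd z) powr (- (real CARD('n) / 2)) + T powr (- b)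
    \<le> shells N T a b z"
proof -
  define n where "n = real CARD('n)"
  define r where "r = 1 + snd z \<bullet> snd z"
  have r: "r \<ge> 1" by (simp add: r_def)
  have t: "fst z \<in> {T / 4..3 * T / 4}" and l: "ln r < real N" and B: "snd z \<in> cball 0 (exp (real N / 2))"
    using cutoff_support[OF assms(1) _ assms(3)] assms(2) by (auto simp: r_def)
  have "z \<in> slab T (exp (real N / 2))"
    using t B by (simp add: slab_def mem_Times_iff)
  then have 2: "T powr (- b) * indicator (slab T (exp (real N / 2))) z = T powr (- b)" by simp
  define k where "k = nat \<lfloor>ln r\<rfloor>"
  have "real k = real_of_int \<lfloor>ln r\<rfloor>" using r by (simp add: k_def)
  then have k: "real k \<le> ln r" "ln r < real (Suc k)"
    using of_int_floor_le[of "ln r"] real_of_int_floor_add_one_gt[of "ln r"] by linarith+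
  \<comment> \<open>The support condition ln r < N ensures that the term with this \<open>k\<close>
    occurs in the sum.\<close>
  have kN: "k < N" using k(1) l by linarith
  have "r < exp (real (Suc k))" using k(2) r by (metis exp_less_mono exp_ln less_le_trans zero_less_one)
  moreover have "(exp (real (Suc k) / 2))\<^sup>2 = exp (real (Suc k))"
    by (simp add: power2_eq_square exp_add[symmetric])
  ultimately have "(norm (snd z))\<^sup>2 \<le> (exp (real (Suc k) / 2))\<^sup>2"
    by (simp add: r_def power2_norm_eq_inner)
  then have "norm (snd z) \<le> exp (real (Suc k) / 2)" by (rule power2_le_imp_le) simp
  then have zk: "z \<in> slab T (exp (real (Suc k) / 2))"
    using t by (simp add: slab_def mem_Times_iff)
  have "r powr (- (n / 2)) = exp (- (n / 2) * ln r)" using r by (simp add: powr_def)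
  also have "\<dots> \<le> exp (- (real k * n / 2))"
    using k(1) by (simp add: n_def field_simps)
  also have "\<dots> = exp (- (real k * n / 2)) * indicator (slab T (exp (real (Suc k) / 2))) z"
    using zk by simp
  also have "\<dots> \<le> (\<Sum>k<N. exp (- (real k * n / 2)) * indicator (slab T (exp (real (Suc k) / 2))) z)"
    using kN by (intro member_le_sum) auto
  finally have "r powr (- (n / 2)) \<le> (\<Sum>k<N. exp (- (real k * n / 2)) * indicator (slab T (exp (real (Suc k) / 2))) z)" .
  then show ?thesis
    unfolding shells_def 2 n_def r_def by (intro add_right_mono mult_left_mono) auto
qed

lemma shells_nonneg: "0 \<le> shells N T a b z"
  unfolding shells_def by (intro add_nonneg_nonneg mult_nonneg_nonneg sum_nonneg) auto

text \<open>The volume factor e^((k+1)n/2) cancels the weight e^(-kn/2) up to e^(n/2), so all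
  \<open>N\<close> terms are equal and N^(-a) becomes N^(1-a). The factor T/2 is the length of the
  time interval of the slab.\<close>

lemma has_bochner_integral_shells:
  assumes "N \<ge> 1" "T > 0"
  shows "has_bochner_integral lebesgue (shells N T a b :: real \<times> (real ^ 'n) \<Rightarrow> real)
    (T / 2 * unit_ball_vol (real CARD('n)) *
      (real N powr (1 - a) * exp (real CARD('n) / 2) + T powr (- b) * exp (real N * real CARD('n) / 2)))"
proof -
  define n where "n = real CARD('n)"
  define V where "V = unit_ball_vol n"
  have pw: "exp x ^ CARD('n) = exp (x * n)" for x
    by (simp add: n_def exp_of_nat_mult[symmetric] mult.commute)
  have I: "has_bochner_integral lebesgue (indicator (slab T (exp x) :: (real \<times> (real ^ 'n)) set) :: _ \<Rightarrow> real)
      (T / 2 * V * exp (x * n))" for x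
    using has_bochner_integral_indicator_slab[of "T / 4" "3 * T / 4" "exp x", where 'a = "real ^ 'n"] assms
    by (simp add: slab_def V_def n_def[symmetric] pw)
  have "has_bochner_integral lebesgue (shells N T a b :: real \<times> (real ^ 'n) \<Rightarrow> real)
    (real N powr (- a) * (\<Sum>k<N. exp (- (real k * n / 2)) * (T / 2 * V * exp (real (Suc k) / 2 * n))) +
     T powr (- b) * (T / 2 * V * exp (real N / 2 * n)))"
    unfolding shells_def[abs_def] n_def[symmetric]
    by (intro has_bochner_integral_add has_bochner_integral_mult_right has_bochner_integral_sum I)
  moreover have e: "exp (- (real k * n / 2)) * (T / 2 * V * exp (real (Suc k) / 2 * n)) = T / 2 * V * exp (n / 2)" for k
  proof -
    have "exp (- (real k * n / 2)) * exp (real (Suc k) / 2 * n) = exp (n / 2)"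
      by (simp add: exp_add[symmetric] field_simps)
    then show ?thesis by (simp add: mult.left_commute)
  qed
  moreover have powN: "real N powr (1 - a) = real N * real N powr (- a)"
    using assms powr_add[of "real N" 1 "- a"] by simp
  moreover have "real N powr (- a) * (\<Sum>k<N. exp (- (real k * n / 2)) * (T / 2 * V * exp (real (Suc k) / 2 * n)))
      = real N powr (- a) * (real N * (T / 2 * V * exp (n / 2)))"
    unfolding e by simp
  ultimately have "has_bochner_integral lebesgue (shells N T a b :: real \<times> (real ^ 'n) \<Rightarrow> real)
      (real N powr (- a) * (real N * (T / 2 * V * exp (n / 2))) + T powr (- b) * (T / 2 * V * exp (real N / 2 * n)))"
    by (simp only:)
  moreover have "real N powr (- a) * (real N * (T / 2 * V * exp (n / 2))) + T powr (- b) * (T / 2 * V * exp (real N / 2 * n))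
      = T / 2 * V * ((real N * real N powr (- a)) * exp (n / 2) + T powr (- b) * exp (real N * n / 2))"
    by (simp add: algebra_simps)
  ultimately show ?thesis
    unfolding n_def[symmetric] V_def[symmetric] by (simp only: powN)
qed

section \<open>Asymptotics of the time and space factors\<close>

lemma continuous_flat: "continuous_on S (flat P)"
  using Ck_on_continuous[OF Ck_on_flat[of 0 P]] continuous_on_subset by blast

lemma continuous_cutoff_factors:
  "continuous_on UNIV (\<lambda>t. flat 1 (time_arg T t))"
  "continuous_on UNIV (\<lambda>x :: real ^ 'n. flat 1 (space_arg L x))"
proof -
  show "continuous_on UNIV (\<lambda>t. flat 1 (time_arg T t))"
    unfolding time_arg_def
    by (rule continuous_on_compose2[OF continuous_flat[of UNIV]]) (auto intro!: continuous_intros simp: divide_inverse)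
  show "continuous_on UNIV (\<lambda>x :: real ^ 'n. flat 1 (space_arg L x))"
    unfolding space_arg_def
    by (rule continuous_on_compose2[OF continuous_flat[of UNIV]])
      (auto intro!: continuous_intros simp: divide_inverse one_plus_inner_pos)
qed

text \<open>On the middle quarter [3T/8, 5T/8] one has |4t/T - 2| \<le> 1/2, so
  \<open>time_arg\<close> is at least 3/4 there. A lower bound linear in \<open>T\<close> is needed
  to divide by \<open>T\<close> later.\<close>

lemma time_factor_integral:
  assumes "T > 0"
  shows "integrable lborel (\<lambda>t. flat 1 (time_arg T t))"
    and "T / 4 * flat 1 (3 / 4) \<le> (LINT t|lborel. flat 1 (time_arg T t))"
proof -
  have s: "flat 1 (time_arg T t) = indicator {T / 4..3 * T / 4} t *\<^sub>R flat 1 (time_arg T t)" for t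
  proof (cases "t \<in> {T / 4..3 * T / 4}")
    case False
    then have "1 \<le> \<bar>4 * t / T - 2\<bar>" using assms by (auto simp: field_simps abs_if)
    then have "1 \<le> (4 * t / T - 2)\<^sup>2" by (metis abs_square_less_1 not_less)
    then have "\<not> time_arg T t > 0" by (simp add: time_arg_def)
    then show ?thesis by (simp add: flat_def)
  qed simp
  have "integrable lborel (\<lambda>t. indicator {T / 4..3 * T / 4} t *\<^sub>R flat 1 (time_arg T t))"
    by (rule borel_integrable_compact) (auto intro: continuous_on_subset[OF continuous_cutoff_factors(1)])
  then show i: "integrable lborel (\<lambda>t. flat 1 (time_arg T t))"
    unfolding s[symmetric] .
  have "has_bochner_integral lborel (indicator {3 * T / 8..5 * T / 8}) (measure lborel {3 * T / 8..5 * T / 8})"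
    by (rule has_bochner_integral_real_indicator) (use assms in auto)
  moreover have "measure lborel {3 * T / 8..5 * T / 8} = T / 4" using assms by simp
  ultimately have "has_bochner_integral lborel (indicator {3 * T / 8..5 * T / 8}) (T / 4)" by metis
  from has_bochner_integral_mult_left[OF this, of "flat 1 (3 / 4)"]
  have j: "has_bochner_integral lborel (\<lambda>t. indicator {3 * T / 8..5 * T / 8} t * flat 1 (3 / 4)) (T / 4 * flat 1 (3 / 4))"
    by simp
  have "(LINT t|lborel. indicator {3 * T / 8..5 * T / 8} t * flat 1 (3 / 4)) \<le> (LINT t|lborel. flat 1 (time_arg T t))"
  proof (rule integral_mono)
    fix t
    show "indicator {3 * T / 8..5 * T / 8} t * flat 1 (3 / 4) \<le> flat 1 (time_arg T t)"
    proof (cases "t \<in> {3 * T / 8..5 * T / 8}")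
      case True
      then have "3 / 2 \<le> 4 * t / T" "4 * t / T \<le> 5 / 2" using assms by (auto simp: field_simps)
      then have "\<bar>4 * t / T - 2\<bar> \<le> 1 / 2" by linarith
      then have "(4 * t / T - 2)\<^sup>2 \<le> (1 / 2)\<^sup>2" using power_mono[of "\<bar>4 * t / T - 2\<bar>" "1 / 2" 2] by simp
      then have "time_arg T t \<ge> 3 / 4" by (simp add: time_arg_def power2_eq_square)
      then show ?thesis using True by (simp add: flat_def divide_le_eq field_simps)
    qed (simp add: flat_1)
  qed (use i j in \<open>auto simp: has_bochner_integral_iff\<close>)
  then show "T / 4 * flat 1 (3 / 4) \<le> (LINT t|lborel. flat 1 (time_arg T t))"
    unfolding has_bochner_integral_integral_eq[OF j] .
qed

lemma space_factor_integrable: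
  fixes F :: "real ^ 'n \<Rightarrow> real"
  assumes "integrable lebesgue F"
  shows "integrable lebesgue (\<lambda>x. flat 1 (space_arg L x) * F x)"
proof (rule Bochner_Integration.integrable_bound[OF assms])
  have "(\<lambda>x :: real ^ 'n. flat 1 (space_arg L x)) \<in> borel_measurable lebesgue"
    using borel_measurable_continuous_onI[OF continuous_cutoff_factors(2)[of L, where 'n = 'n]] by (simp add: measurable_completion)
  then show "(\<lambda>x. flat 1 (space_arg L x) * F x) \<in> borel_measurable lebesgue"
    using assms by auto
  show "AE x in lebesgue. norm (flat 1 (space_arg L x) * F x) \<le> norm (F x)"
    using flat_1 by (intro AE_I2) (auto simp: abs_mult intro!: mult_left_le_one_le)
qed

lemma cutoff_integral:
  fixes F :: "real ^ 'n \<Rightarrow> real"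
  assumes "integrable lebesgue F" "T > 0"
  shows "integrable lebesgue (\<lambda>z. cutoff L T z * F (snd z))"
    and "(LINT z|lebesgue. cutoff L T z * F (snd z)) =
      (LINT t|lborel. flat 1 (time_arg T t)) * (LINT x|lebesgue. flat 1 (space_arg L x) * F x)"
  using integrable_lebesgue_tensor[OF _ time_factor_integral(1)[OF assms(2)] space_factor_integrable[OF assms(1)]]
    lebesgue_integral_tensor[OF _ time_factor_integral(1)[OF assms(2)] space_factor_integrable[OF assms(1)]]
    borel_measurable_continuous_onI[OF continuous_cutoff_factors(1)]
  by (simp_all add: cutoff_def mult.assoc)

text \<open>Dominated convergence with majorant |F|: for fixed \<open>x\<close> the argument tends
  to 1, so the cutoff tends to the positive constant \<open>flat 1 1\<close>.\<close>

lemma space_factor_tendsto: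
  fixes F :: "real ^ 'n \<Rightarrow> real"
  assumes "integrable lebesgue F"
  shows "(\<lambda>N. LINT x|lebesgue. flat 1 (space_arg (real N) x) * F x) \<longlonglongrightarrow> flat 1 1 * (LINT x|lebesgue. F x)"
proof -
  have "(\<lambda>N. LINT x|lebesgue. flat 1 (space_arg (real N) x) * F x) \<longlonglongrightarrow> (LINT x|lebesgue. flat 1 1 * F x)"
  proof (rule integral_dominated_convergence[where w = "\<lambda>x. \<bar>F x\<bar>"])
    show "AE x in lebesgue. (\<lambda>N. flat 1 (space_arg (real N) x) * F x) \<longlonglongrightarrow> flat 1 1 * F x"
    proof (rule AE_I2)
      fix x :: "real ^ 'n"
      have "(\<lambda>N. 1 - ln (1 + x \<bullet> x) * inverse (real N)) \<longlonglongrightarrow> 1 - ln (1 + x \<bullet> x) * 0"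
        by (intro tendsto_diff tendsto_mult tendsto_const lim_inverse_n)
      then have "(\<lambda>N. space_arg (real N) x) \<longlonglongrightarrow> 1" by (simp add: space_arg_def divide_inverse)
      then have "(\<lambda>N. flat 1 (space_arg (real N) x)) \<longlonglongrightarrow> flat 1 1"
        by (rule isCont_tendsto_compose[OF DERIV_isCont[OF flat_has_derivative]])
      then show "(\<lambda>N. flat 1 (space_arg (real N) x) * F x) \<longlonglongrightarrow> flat 1 1 * F x"
        by (rule tendsto_mult[OF _ tendsto_const])
    qed
    show "AE x in lebesgue. norm (flat 1 (space_arg (real N) x) * F x) \<le> \<bar>F x\<bar>" for N
      using flat_1 by (intro AE_I2) (auto simp: abs_mult intro!: mult_left_le_one_le)
  qed (use assms space_factor_integrable[OF assms] in auto)
  then show ?thesis by simp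
qed

text \<open>The left side factors into the time integral, at least of order \<open>T\<close>, and
  \<open>J N\<close>; the right side is \<open>T\<close> times a quantity that tends to 0. Dividing
  by \<open>T\<close> bounds \<open>J N\<close> above by a null sequence, while \<open>J N\<close>
  tends to a positive multiple of the integral of \<open>F\<close>.\<close>

lemma integral_nonpos_of_cutoff_bound:
  fixes F :: "real ^ 'n \<Rightarrow> real"
  assumes F: "integrable lebesgue F" and "a > 1" "b \<ge> 1" "K > 0"
    and bound: "\<And>N T. N \<ge> 1 \<Longrightarrow> T > 0 \<Longrightarrow>
      (LINT z|lebesgue. cutoff (real N) T z * F (snd z))
        \<le> K * (LINT z|lebesgue. shells N T a b (z :: real \<times> (real ^ 'n)))"
  shows "(LINT x|lebesgue. F x) \<le> 0"
proof -
  define n where "n = real CARD('n)"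
  define V where "V = unit_ball_vol n"
  define c where "c = flat 1 (3 / 4)"
  define J where "J N = (LINT x|lebesgue. flat 1 (space_arg (real N) x) * F x)" for N
  have n: "n > 0" and V: "V > 0" and c: "c > 0" by (auto simp: n_def V_def c_def flat_1)
  define R where "R N = real N powr (1 - a) * exp (n / 2) + exp (- (n / 2) * real N)" for N
  have R0: "R N \<ge> 0" for N by (simp add: R_def)
  \<comment> \<open>The lower bound for the time integral may be multiplied by \<open>J N\<close>
    only when \<open>J N\<close> is positive; otherwise the claim follows from
    \<open>R N \<ge> 0\<close>.\<close>
  have J: "J N \<le> 2 * K * V / c * R N" if N: "N \<ge> 1" for N
  proof (cases "J N \<le> 0")
    case True
    moreover have "0 \<le> 2 * K * V / c * R N" using R0[of N] V c assms(4) by simp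
    ultimately show ?thesis by linarith
  next
    case False
    \<comment> \<open>The largest ball has volume of order e^(nN/2). With \<open>b \<ge> 1\<close>
      this \<open>T\<close> makes T^(-b) e^(nN/2) at most e^(-nN/2), the second summand of
      \<open>R N\<close>.\<close>
    define T where "T = exp (n * real N)"
    have T: "T > 0" "T \<ge> 1" using n by (auto simp: T_def)
    have "T powr (- b) \<le> T powr (- 1)" using T assms(3) by (intro powr_mono) auto
    also have "T powr (- 1) = exp (- (n * real N))" by (simp add: T_def powr_def)
    finally have "T powr (- b) * exp (real N * n / 2) \<le> exp (- (n * real N)) * exp (real N * n / 2)"
      by (intro mult_right_mono) auto
    also have "\<dots> = exp (- (n / 2) * real N)" by (simp add: exp_add[symmetric] field_simps)
    finally have Tb: "T powr (- b) * exp (real N * n / 2) \<le> exp (- (n / 2) * real N)" .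
    have "T / 4 * c * J N \<le> (LINT t|lborel. flat 1 (time_arg T t)) * J N"
      using time_factor_integral(2)[OF T(1)] False by (intro mult_right_mono) (auto simp: c_def)
    also have "\<dots> \<le> K * (LINT z|lebesgue. shells N T a b (z :: real \<times> (real ^ 'n)))"
      using bound[OF N T(1)] cutoff_integral(2)[OF F T(1)] by (simp add: J_def)
    also have "\<dots> = K * (T / 2 * V * (real N powr (1 - a) * exp (n / 2) + T powr (- b) * exp (real N * n / 2)))"
      using has_bochner_integral_shells[OF N T(1), of a b, where 'n = 'n]
      by (simp add: has_bochner_integral_iff n_def V_def)
    also have "\<dots> \<le> K * (T / 2 * V * R N)"
      using Tb V T assms(4) by (intro mult_left_mono) (auto simp: R_def)
    finally have "T * (c * J N) \<le> T * (2 * K * V * R N)" by (simp add: field_simps)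
    then have "c * J N \<le> 2 * K * V * R N" using T(1) by (simp only: mult_le_cancel_left_pos)
    then show ?thesis using c by (simp add: field_simps)
  qed
  have "(\<lambda>N. real N powr (1 - a)) \<longlonglongrightarrow> 0"
    using assms(2) by (intro tendsto_neg_powr filterlim_real_sequentially) auto
  moreover have "(\<lambda>N. exp (- (n / 2)) ^ N) \<longlonglongrightarrow> 0"
    using n by (intro LIMSEQ_power_zero) auto
  moreover have "exp (- (n / 2)) ^ N = exp (- (n / 2) * real N)" for N
    by (simp add: exp_of_nat_mult[symmetric] mult.commute)
  ultimately have "(\<lambda>N. 2 * K * V / c * R N) \<longlonglongrightarrow> 2 * K * V / c * (0 * exp (n / 2) + 0)"
    unfolding R_def by (intro tendsto_intros) auto
  then have "(\<lambda>N. 2 * K * V / c * R N) \<longlonglongrightarrow> 0" by simp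
  from LIMSEQ_le[OF space_factor_tendsto[OF F] this] J
  have "flat 1 1 * (LINT x|lebesgue. F x) \<le> 0" unfolding J_def by blast
  moreover have "flat 1 1 > 0" by (simp add: flat_1)
  ultimately show ?thesis by (simp add: mult_le_0_iff)
qed

text \<open>Common skeleton of the critical cases: \<open>A\<close> collects the nonlinear terms and
  \<open>R\<close> the terms with derivatives of the cutoff. After the pointwise bound is
  integrated, the integral of \<open>A\<close> cancels. The error is confined to the support of the
  cutoff, the only place where the shells control the weight.\<close>

lemma integral_nonpos_of_absorption:
  fixes F :: "real ^ 'n \<Rightarrow> real"
  assumes F: "integrable lebesgue F" and "a > 1" "b \<ge> 1" "K > 0"
    and step: "\<And>N T. N \<ge> 1 \<Longrightarrow> T > 0 \<Longrightarrow>
      \<exists>A R. integrable lebesgue A \<and> integrable lebesgue R \<and>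
        (LINT z|lebesgue. A z) + (LINT z|lebesgue. cutoff (real N) T z * F (snd z)) \<le> (LINT z|lebesgue. R z) \<and>
        (\<forall>z :: real \<times> (real ^ 'n). R z \<le> A z + K * (if cutoff (real N) T z = 0 then 0 else
          real N powr (- a) * (1 + snd z \<bullet> snd z) powr (- (real CARD('n) / 2)) + T powr (- b)))"
  shows "(LINT x|lebesgue. F x) \<le> 0"
proof (rule integral_nonpos_of_cutoff_bound[OF assms(1-4)])
  fix N :: nat and T :: real
  assume NT: "N \<ge> 1" "T > 0"
  obtain A R where AR: "integrable lebesgue A" "integrable lebesgue R"
      "(LINT z|lebesgue. A z) + (LINT z|lebesgue. cutoff (real N) T z * F (snd z)) \<le> (LINT z|lebesgue. R z)"
      and le: "\<And>z :: real \<times> (real ^ 'n). R z \<le> A z + K * (if cutoff (real N) T z = 0 then 0 else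
          real N powr (- a) * (1 + snd z \<bullet> snd z) powr (- (real CARD('n) / 2)) + T powr (- b))"
    using step[OF NT] by blast
  have "R z \<le> A z + K * shells N T a b z" for z
  proof -
    have "(if cutoff (real N) T z = 0 then 0 else
          real N powr (- a) * (1 + snd z \<bullet> snd z) powr (- (real CARD('n) / 2)) + T powr (- b)) \<le> shells N T a b z"
      using weight_le_shells[OF _ NT, of z a b] shells_nonneg[of N T a b z] by simp
    from mult_left_mono[OF this less_imp_le[OF assms(4)]] le[of z] show ?thesis by linarith
  qed
  then have "(LINT z|lebesgue. R z) \<le> (LINT z|lebesgue. A z + K * shells N T a b z)"
    using AR has_bochner_integral_shells[OF NT, of a b, where 'n = 'n]
    by (intro integral_mono) (auto simp: has_bochner_integral_iff)
  also have "\<dots> = (LINT z|lebesgue. A z) + K * (LINT z|lebesgue. shells N T a b (z :: real \<times> (real ^ 'n)))"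
    using AR has_bochner_integral_shells[OF NT, of a b, where 'n = 'n]
    by (subst Bochner_Integration.integral_add) (auto simp: has_bochner_integral_iff)
  finally show "(LINT z|lebesgue. cutoff (real N) T z * F (snd z))
        \<le> K * (LINT z|lebesgue. shells N T a b (z :: real \<times> (real ^ 'n)))"
    using AR(3) by simp
qed

section \<open>Absorption at the two critical exponents\<close>

lemma continuous_cutoff_derivatives:
  "continuous_on UNIV (cutoff L T :: real \<times> (real ^ 'n) \<Rightarrow> real)"
  "continuous_on UNIV (dir_deriv time_dir (cutoff L T) :: real \<times> (real ^ 'n) \<Rightarrow> real)"
  "continuous_on UNIV (dir_deriv (space_dir i) (cutoff L T) :: real \<times> (real ^ 'n) \<Rightarrow> real)"
  "continuous_on UNIV (dir_deriv (space_dir i) (dir_deriv (space_dir i) (cutoff L T)) :: real \<times> (real ^ 'n) \<Rightarrow> real)"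
  "continuous_on UNIV (space_laplacian (cutoff L T) :: real \<times> (real ^ 'n) \<Rightarrow> real)"
proof -
  have s: "smooth_on UNIV (dir_deriv (space_dir i) (cutoff L T) :: real \<times> (real ^ 'n) \<Rightarrow> real)" for i
    by (rule smooth_on_dir_deriv[OF smooth_cutoff space_dir_in_Basis])
  have d2: "continuous_on UNIV (dir_deriv (space_dir i) (dir_deriv (space_dir i) (cutoff L T)) :: real \<times> (real ^ 'n) \<Rightarrow> real)" for i
    by (rule smooth_on_imp_continuous_on[OF smooth_on_dir_deriv[OF s space_dir_in_Basis]])
  show "continuous_on UNIV (cutoff L T :: real \<times> (real ^ 'n) \<Rightarrow> real)"
    by (rule smooth_on_imp_continuous_on[OF smooth_cutoff])
  show "continuous_on UNIV (dir_deriv time_dir (cutoff L T) :: real \<times> (real ^ 'n) \<Rightarrow> real)"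
    by (rule smooth_on_imp_continuous_on[OF smooth_on_dir_deriv[OF smooth_cutoff time_dir_in_Basis]])
  show "continuous_on UNIV (dir_deriv (space_dir i) (cutoff L T) :: real \<times> (real ^ 'n) \<Rightarrow> real)"
    by (rule smooth_on_imp_continuous_on[OF s])
  show "continuous_on UNIV (dir_deriv (space_dir i) (dir_deriv (space_dir i) (cutoff L T)) :: real \<times> (real ^ 'n) \<Rightarrow> real)"
    by (rule d2)
  show "continuous_on UNIV (space_laplacian (cutoff L T) :: real \<times> (real ^ 'n) \<Rightarrow> real)"
    unfolding space_laplacian_def[abs_def] by (intro continuous_on_sum d2)
qed

text \<open>The critical exponent enters through \<open>p' = n/2\<close>, which makes the weight
  \<open>(1/(L(1 + |x|\<^sup>2)))\<^bsup>p'\<^esup>\<close> borderline: over the support of the cutoff its integral is of order \<open>L\<^bsup>1-p'\<^esup>\<close>.\<close>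

lemma integral_nonpos_of_diffusion_bound:
  fixes F :: "real ^ 'n \<Rightarrow> real" and u :: "real \<times> (real ^ 'n) \<Rightarrow> 'b::euclidean_space"
  assumes n: "CARD('n) \<ge> 3" and p: "p = real CARD('n) / (real CARD('n) - 2)" and l: "l > 0"
    and F: "integrable lebesgue F"
    and u: "\<And>T. T > 0 \<Longrightarrow> Lp_loc p (cylinder T) u"
    and bound: "\<And>N T. N \<ge> 1 \<Longrightarrow> T > 0 \<Longrightarrow>
      l * (LINT z|lebesgue. cutoff (real N) T z * norm (u z) powr p) +
      (LINT z|lebesgue. cutoff (real N) T z * F (snd z)) \<le>
      (LINT z|lebesgue. \<bar>space_laplacian (cutoff (real N) T) z\<bar> * norm (u z)) +
      (LINT z|lebesgue. \<bar>dir_deriv time_dir (cutoff (real N) T) z\<bar> * norm (u z))"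
  shows "(LINT x|lebesgue. F x) \<le> 0"
proof -
  define n where "n = real CARD('n)"
  have n3: "n \<ge> 3" using n by (simp add: n_def)
  have p1: "p > 1" and q: "p / (p - 1) = n / 2" using n3 by (auto simp: p n_def[symmetric] field_simps)
  obtain C where C: "C > 0" and deriv: "\<And>L T z. L \<ge> 1 \<Longrightarrow> T > 0 \<Longrightarrow>
    \<bar>dir_deriv time_dir (cutoff L T) z\<bar> \<le> C * (1 / T) * cutoff L T z powr (1 / p) \<and>
    \<bar>space_laplacian (cutoff L T) z\<bar> \<le> C * (1 / (L * (1 + snd z \<bullet> snd (z :: real \<times> (real ^ 'n))))) * cutoff L T z powr (1 / p)"
    using cutoff_derivative_bounds[of "1 / p", where 'n = 'n] p1 by auto
  \<comment> \<open>\<open>l / 2\<close>, because the Laplacian and the time derivative both have to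
    be absorbed by the one term with coefficient \<open>l\<close>.\<close>
  obtain K where K: "K > 0" and young: "\<And>U V \<sigma>. U \<ge> 0 \<Longrightarrow> V \<ge> 0 \<Longrightarrow> \<sigma> \<ge> 0 \<Longrightarrow>
    U * (C * \<sigma> * V powr (1 / p)) \<le> l / 2 * (V * U powr p) + K * \<sigma> powr (n / 2)"
    using Youngs_inequality_weighted[OF p1, of "l / 2" C] l C q by auto
  show ?thesis
  \<comment> \<open>Both exponents are n/2, since Young is used with the same \<open>p\<close> for
    space and time; n \<ge> 3 makes n/2 exceed 1.\<close>
  proof (rule integral_nonpos_of_absorption[OF F _ _ K, of "n / 2" "n / 2"])
    fix N :: nat and T :: real
    assume NT: "N \<ge> 1" "T > 0"
    let ?\<phi> = "cutoff (real N) T :: real \<times> (real ^ 'n) \<Rightarrow> real"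
    let ?R = "\<lambda>z. \<bar>space_laplacian ?\<phi> z\<bar> * norm (u z) + \<bar>dir_deriv time_dir ?\<phi> z\<bar> * norm (u z)"
    have N: "real N > 0" using NT by simp
    note sl = slab_props[OF NT(2), of "real N", where 'n = 'n]
    note z0 = cutoff_derivatives_eq_0[OF N NT(2)]
    have A: "integrable lebesgue (\<lambda>z. ?\<phi> z * norm (u z) powr p)"
      by (rule integrable_Lp_loc_cutoff(1)[OF u[OF NT(2)] sl continuous_cutoff_derivatives(1)]) (rule z0)
    have R1: "integrable lebesgue (\<lambda>z. \<bar>space_laplacian ?\<phi> z\<bar> * norm (u z))"
      using integrable_norm[OF integrable_Lp_loc_cutoff(2)[OF u[OF NT(2)] sl continuous_cutoff_derivatives(5) z0(5)]] p1
      by simp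
    have R2: "integrable lebesgue (\<lambda>z. \<bar>dir_deriv time_dir ?\<phi> z\<bar> * norm (u z))"
      using integrable_norm[OF integrable_Lp_loc_cutoff(2)[OF u[OF NT(2)] sl continuous_cutoff_derivatives(2) z0(2)]] p1
      by simp
    have "?R z \<le> l * (?\<phi> z * norm (u z) powr p) + K * (if ?\<phi> z = 0 then 0 else
          real N powr (- (n / 2)) * (1 + snd z \<bullet> snd z) powr (- (n / 2)) + T powr (- (n / 2)))" for z
    proof (cases "?\<phi> z = 0")
      \<comment> \<open>The derivatives vanish together with the cutoff: they are bounded by a
        multiple of its power 1/p, and \<open>0 powr (1 / p) = 0\<close>.\<close>
      case True
      then show ?thesis using deriv[of "real N" T z] NT by simp
    next
      case False
      define r where "r = 1 + snd z \<bullet> snd z"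
      have r: "r > 0" by (simp add: r_def one_plus_inner_pos)
      have "\<bar>space_laplacian ?\<phi> z\<bar> * norm (u z) \<le> norm (u z) * (C * (1 / (real N * r)) * ?\<phi> z powr (1 / p))"
        using deriv[of "real N" T z] NT unfolding r_def by (subst mult.commute) (intro mult_left_mono, auto)
      also have "\<dots> \<le> l / 2 * (?\<phi> z * norm (u z) powr p) + K * (1 / (real N * r)) powr (n / 2)"
        using r N cutoff_nonneg[of "real N" T z] by (intro young) auto
      also have "(1 / (real N * r)) powr (n / 2) = real N powr (- (n / 2)) * r powr (- (n / 2))"
        using r N by (simp add: powr_divide powr_mult powr_minus field_simps)
      finally have 1: "\<bar>space_laplacian ?\<phi> z\<bar> * norm (u z) \<le> l / 2 * (?\<phi> z * norm (u z) powr p) +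
          K * (real N powr (- (n / 2)) * r powr (- (n / 2)))" .
      have "\<bar>dir_deriv time_dir ?\<phi> z\<bar> * norm (u z) \<le> norm (u z) * (C * (1 / T) * ?\<phi> z powr (1 / p))"
        using deriv[of "real N" T z] NT by (subst mult.commute) (intro mult_left_mono, auto)
      also have "\<dots> \<le> l / 2 * (?\<phi> z * norm (u z) powr p) + K * (1 / T) powr (n / 2)"
        using NT cutoff_nonneg[of "real N" T z] by (intro young) auto
      also have "(1 / T) powr (n / 2) = T powr (- (n / 2))"
        using NT by (simp add: powr_divide powr_minus field_simps)
      finally have 2: "\<bar>dir_deriv time_dir ?\<phi> z\<bar> * norm (u z) \<le> l / 2 * (?\<phi> z * norm (u z) powr p) + K * T powr (- (n / 2))" .
      have "?R z \<le> l / 2 * (?\<phi> z * norm (u z) powr p) + l / 2 * (?\<phi> z * norm (u z) powr p) +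
          (K * (real N powr (- (n / 2)) * r powr (- (n / 2))) + K * T powr (- (n / 2)))"
        using add_mono[OF 1 2] by linarith
      also have "\<dots> = l * (?\<phi> z * norm (u z) powr p) + K * (real N powr (- (n / 2)) * r powr (- (n / 2)) + T powr (- (n / 2)))"
        by (simp add: algebra_simps)
      finally show ?thesis using False by (simp add: r_def)
    qed
    moreover have "(LINT z|lebesgue. l * (?\<phi> z * norm (u z) powr p)) + (LINT z|lebesgue. ?\<phi> z * F (snd z)) \<le> integral\<^sup>L lebesgue ?R"
      using bound[OF NT] Bochner_Integration.integral_add[OF R1 R2] by simp
    moreover have "integrable lebesgue (\<lambda>z. l * (?\<phi> z * norm (u z) powr p))" using A by simp
    moreover have "integrable lebesgue ?R" using R1 R2 by simp
    ultimately show "\<exists>A R. integrable lebesgue A \<and> integrable lebesgue R \<and>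
        (LINT z|lebesgue. A z) + (LINT z|lebesgue. cutoff (real N) T z * F (snd z)) \<le> (LINT z|lebesgue. R z) \<and>
        (\<forall>z :: real \<times> (real ^ 'n). R z \<le> A z + K * (if cutoff (real N) T z = 0 then 0 else
          real N powr (- (n / 2)) * (1 + snd z \<bullet> snd z) powr (- (real CARD('n) / 2)) + T powr (- (n / 2))))"
      unfolding n_def[symmetric] by blast
  qed (use n3 in auto)
qed

text \<open>Here q' = n, and the first-order weight 1/(L sqrt(1 + |x|^2)) raised to n is the same
  borderline weight (1 + |x|^2)^(-n/2), now with L^(-n). The flux is absorbed by \<open>m\<close>
  and the time derivative by \<open>l\<close>, whence the time exponent p'. The gradient may depend
  on \<open>T\<close>, so the bound is existential in \<open>g\<close>.\<close>

lemma integral_nonpos_of_gradient_bound: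
  fixes F :: "real ^ 'n \<Rightarrow> real" and u :: "real \<times> (real ^ 'n) \<Rightarrow> 'b::euclidean_space"
  assumes n: "CARD('n) \<ge> 2" and q: "q = real CARD('n) / (real CARD('n) - 1)" and p: "p > 1"
    and l: "l > 0" and m: "m > 0"
    and F: "integrable lebesgue F"
    and u: "\<And>T. T > 0 \<Longrightarrow> Lp_loc p (cylinder T) u"
    and bound: "\<And>N T. N \<ge> 1 \<Longrightarrow> T > 0 \<Longrightarrow> \<exists>g :: real \<times> (real ^ 'n) \<Rightarrow> 'c::euclidean_space.
      Lp_loc q (cylinder T) g \<and>
      l * (LINT z|lebesgue. cutoff (real N) T z * norm (u z) powr p) +
      m * (LINT z|lebesgue. cutoff (real N) T z * norm (g z) powr q) +
      (LINT z|lebesgue. cutoff (real N) T z * F (snd z)) \<le>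
      (LINT z|lebesgue. (\<Sum>i\<in>UNIV. \<bar>dir_deriv (space_dir i) (cutoff (real N) T) z\<bar>) * norm (g z)) +
      (LINT z|lebesgue. \<bar>dir_deriv time_dir (cutoff (real N) T) z\<bar> * norm (u z))"
  shows "(LINT x|lebesgue. F x) \<le> 0"
proof -
  define n where "n = real CARD('n)"
  have n2: "n \<ge> 2" using n by (simp add: n_def)
  have q1: "q > 1" and q': "q / (q - 1) = n" using n2 by (auto simp: q n_def[symmetric] field_simps)
  define b where "b = p / (p - 1)"
  have b: "b \<ge> 1" using p by (simp add: b_def field_simps)
  obtain C1 where C1: "C1 > 0" and deriv1: "\<And>L T z. L \<ge> 1 \<Longrightarrow> T > 0 \<Longrightarrow>
    \<bar>dir_deriv time_dir (cutoff L T) (z :: real \<times> (real ^ 'n))\<bar> \<le> C1 * (1 / T) * cutoff L T z powr (1 / p)"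
    using cutoff_derivative_bounds[of "1 / p", where 'n = 'n] p by auto
  obtain C2 where C2: "C2 > 0" and deriv2: "\<And>L T z. L \<ge> 1 \<Longrightarrow> T > 0 \<Longrightarrow>
    (\<Sum>i\<in>UNIV. \<bar>dir_deriv (space_dir i) (cutoff L T) z\<bar>)
      \<le> C2 * (1 / (L * sqrt (1 + snd z \<bullet> snd (z :: real \<times> (real ^ 'n))))) * cutoff L T z powr (1 / q)"
    using cutoff_derivative_bounds[of "1 / q", where 'n = 'n] q1 by auto
  obtain K1 where K1: "K1 > 0" and young1: "\<And>U V \<sigma>. U \<ge> 0 \<Longrightarrow> V \<ge> 0 \<Longrightarrow> \<sigma> \<ge> 0 \<Longrightarrow>
    U * (C1 * \<sigma> * V powr (1 / p)) \<le> l * (V * U powr p) + K1 * \<sigma> powr b"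
    using Youngs_inequality_weighted[OF p l, of C1] C1 by (auto simp: b_def)
  obtain K2 where K2: "K2 > 0" and young2: "\<And>U V \<sigma>. U \<ge> 0 \<Longrightarrow> V \<ge> 0 \<Longrightarrow> \<sigma> \<ge> 0 \<Longrightarrow>
    U * (C2 * \<sigma> * V powr (1 / q)) \<le> m * (V * U powr q) + K2 * \<sigma> powr n"
    using Youngs_inequality_weighted[OF q1 m, of C2] C2 q' by auto
  define K where "K = K1 + K2"
  have K: "K > 0" using K1 K2 by (simp add: K_def)
  show ?thesis
  proof (rule integral_nonpos_of_absorption[OF F _ b K, of n])
    fix N :: nat and T :: real
    assume NT: "N \<ge> 1" "T > 0"
    let ?\<phi> = "cutoff (real N) T :: real \<times> (real ^ 'n) \<Rightarrow> real"
    obtain g :: "real \<times> (real ^ 'n) \<Rightarrow> 'c" where g: "Lp_loc q (cylinder T) g"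
      and ineq: "l * (LINT z|lebesgue. ?\<phi> z * norm (u z) powr p) + m * (LINT z|lebesgue. ?\<phi> z * norm (g z) powr q) +
        (LINT z|lebesgue. ?\<phi> z * F (snd z)) \<le>
        (LINT z|lebesgue. (\<Sum>i\<in>UNIV. \<bar>dir_deriv (space_dir i) ?\<phi> z\<bar>) * norm (g z)) +
        (LINT z|lebesgue. \<bar>dir_deriv time_dir ?\<phi> z\<bar> * norm (u z))"
      using bound[OF NT] by (elim exE conjE)
    let ?G = "\<lambda>z. \<Sum>i\<in>UNIV. \<bar>dir_deriv (space_dir i) ?\<phi> z\<bar>"
    let ?R = "\<lambda>z. ?G z * norm (g z) + \<bar>dir_deriv time_dir ?\<phi> z\<bar> * norm (u z)"
    have N: "real N > 0" using NT by simp
    note sl = slab_props[OF NT(2), of "real N", where 'n = 'n]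
    note z0 = cutoff_derivatives_eq_0[OF N NT(2)]
    have A1: "integrable lebesgue (\<lambda>z. ?\<phi> z * norm (u z) powr p)"
      by (rule integrable_Lp_loc_cutoff(1)[OF u[OF NT(2)] sl continuous_cutoff_derivatives(1)]) (rule z0)
    have A2: "integrable lebesgue (\<lambda>z. ?\<phi> z * norm (g z) powr q)"
      by (rule integrable_Lp_loc_cutoff(1)[OF g sl continuous_cutoff_derivatives(1)]) (rule z0)
    have "continuous_on UNIV ?G"
      by (intro continuous_on_sum continuous_on_rabs continuous_cutoff_derivatives)
    moreover have "?G z = 0" if "z \<notin> slab T (exp (real N / 2))" for z
      using z0(3)[OF that] by simp
    ultimately have R1: "integrable lebesgue (\<lambda>z. ?G z * norm (g z))"
      using integrable_norm[OF integrable_Lp_loc_cutoff(2)[OF g sl, of ?G]] q1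
      by (simp add: sum_nonneg)
    have R2: "integrable lebesgue (\<lambda>z. \<bar>dir_deriv time_dir ?\<phi> z\<bar> * norm (u z))"
      using integrable_norm[OF integrable_Lp_loc_cutoff(2)[OF u[OF NT(2)] sl continuous_cutoff_derivatives(2) z0(2)]] p
      by simp
    have "?R z \<le> (l * (?\<phi> z * norm (u z) powr p) + m * (?\<phi> z * norm (g z) powr q)) + K * (if ?\<phi> z = 0 then 0 else
          real N powr (- n) * (1 + snd z \<bullet> snd z) powr (- (n / 2)) + T powr (- b))" for z
    proof (cases "?\<phi> z = 0")
      case True
      have "?G z \<le> 0" "\<bar>dir_deriv time_dir ?\<phi> z\<bar> \<le> 0"
        using deriv1[of "real N" T z] deriv2[of "real N" T z] NT True by auto
      then have "?R z \<le> 0" by (intro add_nonpos_nonpos mult_nonpos_nonneg) auto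
      then show ?thesis using True by simp
    next
      case False
      define r where "r = 1 + snd z \<bullet> snd z"
      have r: "r > 0" by (simp add: r_def one_plus_inner_pos)
      have "?G z * norm (g z) \<le> norm (g z) * (C2 * (1 / (real N * sqrt r)) * ?\<phi> z powr (1 / q))"
        using deriv2[of "real N" T z] NT unfolding r_def by (subst mult.commute) (intro mult_left_mono, auto)
      also have "\<dots> \<le> m * (?\<phi> z * norm (g z) powr q) + K2 * (1 / (real N * sqrt r)) powr n"
        using r N cutoff_nonneg[of "real N" T z] by (intro young2) auto
      also have "(1 / (real N * sqrt r)) powr n = real N powr (- n) * r powr (- (n / 2))"
        using r N by (simp add: powr_divide powr_mult powr_minus powr_half_sqrt[symmetric] powr_powr field_simps)
      also have "K2 * \<dots> \<le> K * \<dots>"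
        using K1 by (intro mult_right_mono) (auto simp: K_def)
      finally have 1: "?G z * norm (g z) \<le> m * (?\<phi> z * norm (g z) powr q) +
          K * (real N powr (- n) * r powr (- (n / 2)))" by simp
      have "\<bar>dir_deriv time_dir ?\<phi> z\<bar> * norm (u z) \<le> norm (u z) * (C1 * (1 / T) * ?\<phi> z powr (1 / p))"
        using deriv1[of "real N" T z] NT by (subst mult.commute) (intro mult_left_mono, auto)
      also have "\<dots> \<le> l * (?\<phi> z * norm (u z) powr p) + K1 * (1 / T) powr b"
        using NT cutoff_nonneg[of "real N" T z] by (intro young1) auto
      also have "(1 / T) powr b = T powr (- b)"
        using NT by (simp add: powr_divide powr_minus field_simps)
      also have "K1 * \<dots> \<le> K * \<dots>"
        using K2 by (intro mult_right_mono) (auto simp: K_def)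
      finally have 2: "\<bar>dir_deriv time_dir ?\<phi> z\<bar> * norm (u z) \<le> l * (?\<phi> z * norm (u z) powr p) + K * T powr (- b)"
        by simp
      have "?R z \<le> (l * (?\<phi> z * norm (u z) powr p) + m * (?\<phi> z * norm (g z) powr q)) +
          (K * (real N powr (- n) * r powr (- (n / 2))) + K * T powr (- b))"
        using add_mono[OF 1 2] by linarith
      then show ?thesis using False by (simp add: r_def distrib_left)
    qed
    moreover have "(LINT z|lebesgue. l * (?\<phi> z * norm (u z) powr p) + m * (?\<phi> z * norm (g z) powr q)) +
        (LINT z|lebesgue. ?\<phi> z * F (snd z)) \<le> integral\<^sup>L lebesgue ?R"
      using ineq Bochner_Integration.integral_add[OF R1 R2] A1 A2 by simp
    moreover have "integrable lebesgue (\<lambda>z. l * (?\<phi> z * norm (u z) powr p) + m * (?\<phi> z * norm (g z) powr q))"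
      using A1 A2 by simp
    moreover have "integrable lebesgue ?R" using R1 R2 by simp
    ultimately show "\<exists>A R. integrable lebesgue A \<and> integrable lebesgue R \<and>
        (LINT z|lebesgue. A z) + (LINT z|lebesgue. cutoff (real N) T z * F (snd z)) \<le> (LINT z|lebesgue. R z) \<and>
        (\<forall>z :: real \<times> (real ^ 'n). R z \<le> A z + K * (if cutoff (real N) T z = 0 then 0 else
          real N powr (- n) * (1 + snd z \<bullet> snd z) powr (- (real CARD('n) / 2)) + T powr (- b)))"
      unfolding n_def[symmetric] by blast
  qed (use n2 in auto)
qed

section \<open>Weak solutions\<close>

lemma integrable_complexI:
  assumes "integrable M (\<lambda>x. Re (f x))" "integrable M (\<lambda>x. Im (f x))"
  shows "integrable M f"
proof -
  have "integrable M (\<lambda>x. of_real (Re (f x)) + \<i> * of_real (Im (f x)))"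
    using assms by simp
  then show ?thesis by (simp add: complex_eq[symmetric])
qed

lemma spacetime_integral_cutoff:
  fixes v :: "real \<times> (real ^ 'n) \<Rightarrow> complex" and \<psi> :: "real \<times> (real ^ 'n) \<Rightarrow> real"
  assumes v: "Lp_loc p (cylinder T) v" "p \<ge> 1" and T: "T > 0"
    and \<psi>: "continuous_on UNIV \<psi>" "\<And>z. z \<notin> slab T (exp (L / 2)) \<Longrightarrow> \<psi> z = 0"
  shows "integrable lebesgue (\<lambda>z. v z * of_real (\<psi> z))"
    and "spacetime_integral T (\<lambda>z. v z * of_real (\<psi> z)) = (LINT z|lebesgue. v z * of_real (\<psi> z))"
    and "norm (spacetime_integral T (\<lambda>z. v z * of_real (\<psi> z))) \<le> (LINT z|lebesgue. \<bar>\<psi> z\<bar> * norm (v z))"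
proof -
  show i: "integrable lebesgue (\<lambda>z. v z * of_real (\<psi> z))"
    using integrable_Lp_loc_cutoff(2)[OF v(1) slab_props[OF T, of L] \<psi> v(2)]
    by (simp add: scaleR_conv_of_real mult.commute)
  show e: "spacetime_integral T (\<lambda>z. v z * of_real (\<psi> z)) = (LINT z|lebesgue. v z * of_real (\<psi> z))"
    using \<psi>(2) slab_props(2)[OF T, of L] by (intro spacetime_integral_eq[OF i]) auto
  show "norm (spacetime_integral T (\<lambda>z. v z * of_real (\<psi> z))) \<le> (LINT z|lebesgue. \<bar>\<psi> z\<bar> * norm (v z))"
    using integral_norm_bound[of lebesgue "\<lambda>z. v z * of_real (\<psi> z)"] unfolding e
    by (simp add: norm_mult mult.commute)
qed

text \<open>Taking the real part under the integral needs integrability of the complex integrand,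
  hence of the real and imaginary parts of \<open>f\<close>. The equation without gradient term is
  covered by \<open>mu = 0\<close> with \<open>u\<close> in place of \<open>g\<close>.\<close>

lemma Re_source_term:
  fixes u :: "real \<times> (real ^ 'n) \<Rightarrow> 'a::euclidean_space" and g :: "real \<times> (real ^ 'n) \<Rightarrow> 'b::euclidean_space"
    and f :: "real ^ 'n \<Rightarrow> complex" and T L :: real
  defines "\<phi> \<equiv> cutoff L T"
  assumes u: "Lp_loc p (cylinder T) u" and g: "Lp_loc q (cylinder T) g"
    and f: "integrable lebesgue (\<lambda>x. Re (f x))" "integrable lebesgue (\<lambda>x. Im (f x))"
    and T: "T > 0" and L: "L > 0"
  shows "Re (spacetime_integral T (\<lambda>z. (lam * of_real (norm (u z) powr p) +
      mu * of_real (norm (g z) powr q) + f (snd z)) * of_real (\<phi> z))) =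
    Re lam * (LINT z|lebesgue. \<phi> z * norm (u z) powr p) +
    Re mu * (LINT z|lebesgue. \<phi> z * norm (g z) powr q) +
    (LINT z|lebesgue. \<phi> z * Re (f (snd z)))"
proof -
  note z0 = cutoff_derivatives_eq_0(1)[OF L T, where 'n = 'n, folded \<phi>_def]
  note sl = slab_props[OF T, of L, where 'n = 'n]
  note c = continuous_cutoff_derivatives(1)[of L T, where 'n = 'n, folded \<phi>_def]
  have U: "integrable lebesgue (\<lambda>z. \<phi> z * norm (u z) powr p)"
    by (rule integrable_Lp_loc_cutoff(1)[OF u sl c z0])
  have G: "integrable lebesgue (\<lambda>z. \<phi> z * norm (g z) powr q)"
    by (rule integrable_Lp_loc_cutoff(1)[OF g sl c z0])
  have R: "integrable lebesgue (\<lambda>z. \<phi> z * Re (f (snd z)))" and I: "integrable lebesgue (\<lambda>z. \<phi> z * Im (f (snd z)))"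
    unfolding \<phi>_def by (rule cutoff_integral(1)[OF f(1) T], rule cutoff_integral(1)[OF f(2) T])
  let ?H = "\<lambda>z. (lam * of_real (norm (u z) powr p) + mu * of_real (norm (g z) powr q) + f (snd z)) * of_real (\<phi> z)"
  have re: "Re (?H z) = Re lam * (\<phi> z * norm (u z) powr p) + Re mu * (\<phi> z * norm (g z) powr q) + \<phi> z * Re (f (snd z))" for z
    by (simp add: algebra_simps)
  have im: "Im (?H z) = Im lam * (\<phi> z * norm (u z) powr p) + Im mu * (\<phi> z * norm (g z) powr q) + \<phi> z * Im (f (snd z))" for z
    by (simp add: algebra_simps)
  have H: "integrable lebesgue ?H"
  proof (rule integrable_complexI)
    show "integrable lebesgue (\<lambda>z. Re (?H z))" unfolding re using U G R by simp
    show "integrable lebesgue (\<lambda>z. Im (?H z))" unfolding im using U G I by simp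
  qed
  have "spacetime_integral T ?H = integral\<^sup>L lebesgue ?H"
    using z0 sl(2) by (intro spacetime_integral_eq[OF H]) auto
  then have "Re (spacetime_integral T ?H) = (LINT z|lebesgue. Re (?H z))"
    using integral_Re[OF H] by simp
  also have "\<dots> = Re lam * (LINT z|lebesgue. \<phi> z * norm (u z) powr p) +
    Re mu * (LINT z|lebesgue. \<phi> z * norm (g z) powr q) + (LINT z|lebesgue. \<phi> z * Re (f (snd z)))"
    unfolding re using U G R by simp
  finally show ?thesis .
qed

text \<open>The time support starts at T/4; hence \<open>u0\<close> drops out of every
  estimate.\<close>

lemma cutoff_initial_eq_0:
  fixes x :: "real ^ 'n"
  assumes "L > 0" "T > 0"
  shows "cutoff L T (0, x) = 0"
  by (rule cutoff_derivatives_eq_0(1)[OF assms]) (use assms in \<open>auto simp: slab_def\<close>)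

lemma Re_diff_le:
  assumes "norm a \<le> A" "norm b \<le> B" "s = 1 \<or> s = - 1"
  shows "s * Re (a - \<i> * b) \<le> A + B"
proof -
  have "s * Re (a - \<i> * b) \<le> \<bar>Re (a - \<i> * b)\<bar>" using assms(3) by auto
  also have "\<dots> \<le> norm (a - \<i> * b)" by (rule abs_Re_le_cmod)
  also have "\<dots> \<le> norm a + norm b" using norm_triangle_ineq4[of a "\<i> * b"] by (simp add: norm_mult)
  finally show ?thesis using assms by linarith
qed

text \<open>Only the real part of the weak formulation is used, multiplied by the sign \<open>s\<close> of the
  dominating coefficient.\<close>

lemma weak_solution_zero_bound:
  fixes u :: "real \<times> (real ^ 'n) \<Rightarrow> complex" and f :: "real ^ 'n \<Rightarrow> complex" and N T :: real
  defines "\<phi> \<equiv> cutoff N T"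
  assumes w: "weak_solution_zero lam p f u0 T u" and p: "p \<ge> 1" and T: "T > 0" and N: "N > 0"
    and f: "integrable lebesgue (\<lambda>x. Re (f x))" "integrable lebesgue (\<lambda>x. Im (f x))"
    and s: "s = 1 \<or> s = - 1"
  shows "s * Re lam * (LINT z|lebesgue. \<phi> z * norm (u z) powr p) + (LINT z|lebesgue. \<phi> z * (s * Re (f (snd z))))
    \<le> (LINT z|lebesgue. \<bar>space_laplacian \<phi> z\<bar> * norm (u z)) + (LINT z|lebesgue. \<bar>dir_deriv time_dir \<phi> z\<bar> * norm (u z))"
proof -
  note z0 = cutoff_derivatives_eq_0[OF N T, where 'n = 'n, folded \<phi>_def]
  note c = continuous_cutoff_derivatives[where L = N and T = T and 'n = 'n, folded \<phi>_def]
  have u: "Lp_loc p (cylinder T) u" using w by (simp add: weak_solution_zero_def)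
  have "test_function T \<phi>" unfolding \<phi>_def by (rule cutoff_test_function[OF N T])
  then have "\<i> * (LINT x|lebesgue. u0 x * of_real (\<phi> (0, x))) +
        spacetime_integral T (\<lambda>z. (lam * of_real (norm (u z) powr p) + f (snd z)) * of_real (\<phi> z)) =
        spacetime_integral T (\<lambda>z. u z * of_real (space_laplacian \<phi> z)) -
        \<i> * spacetime_integral T (\<lambda>z. u z * of_real (dir_deriv time_dir \<phi> z))"
    using w unfolding weak_solution_zero_def by blast
  then have "spacetime_integral T (\<lambda>z. (lam * of_real (norm (u z) powr p) + f (snd z)) * of_real (\<phi> z)) =
        spacetime_integral T (\<lambda>z. u z * of_real (space_laplacian \<phi> z)) -
        \<i> * spacetime_integral T (\<lambda>z. u z * of_real (dir_deriv time_dir \<phi> z))"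
    using cutoff_initial_eq_0[OF N T, where 'n = 'n] by (simp add: \<phi>_def)
  then have "s * Re (spacetime_integral T (\<lambda>z. (lam * of_real (norm (u z) powr p) + f (snd z)) * of_real (\<phi> z)))
    \<le> (LINT z|lebesgue. \<bar>space_laplacian \<phi> z\<bar> * norm (u z)) + (LINT z|lebesgue. \<bar>dir_deriv time_dir \<phi> z\<bar> * norm (u z))"
    using Re_diff_le[OF spacetime_integral_cutoff(3)[OF u p T c(5) z0(5)]
        spacetime_integral_cutoff(3)[OF u p T c(2) z0(2)] s] by simp
  moreover have "(LINT z|lebesgue. \<phi> z * (s * Re (f (snd z)))) = s * (LINT z|lebesgue. \<phi> z * Re (f (snd z)))"
    by (simp add: mult.left_commute)
  ultimately show ?thesis
    using Re_source_term[OF u u f T N, of lam 0] by (simp add: \<phi>_def distrib_left mult.assoc)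
qed

text \<open>Two bounds for the same gradient: the first keeps the flux in terms of \<open>g\<close>,
  for critical \<open>q\<close>; the second moves the remaining derivative back onto the cutoff and
  leaves \<open>u\<close>, for critical \<open>p\<close>.\<close>

lemma weak_solution_nonzero_bound:
  fixes u :: "real \<times> (real ^ 'n) \<Rightarrow> complex" and f :: "real ^ 'n \<Rightarrow> complex" and N T :: real
  assumes w: "weak_solution_nonzero lam mu p q f u0 T u" and p: "p \<ge> 1" and q: "q \<ge> 1" and T: "T > 0" and N: "N > 0"
    and f: "integrable lebesgue (\<lambda>x. Re (f x))" "integrable lebesgue (\<lambda>x. Im (f x))"
    and s: "s = 1 \<or> s = - 1"
  obtains g :: "real \<times> (real ^ 'n) \<Rightarrow> complex ^ 'n" where "Lp_loc q (cylinder T) g"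
    "s * Re lam * (LINT z|lebesgue. cutoff N T z * norm (u z) powr p) +
      s * Re mu * (LINT z|lebesgue. cutoff N T z * norm (g z) powr q) +
      (LINT z|lebesgue. cutoff N T z * (s * Re (f (snd z))))
    \<le> (LINT z|lebesgue. (\<Sum>i\<in>UNIV. \<bar>dir_deriv (space_dir i) (cutoff N T) z\<bar>) * norm (g z)) +
      (LINT z|lebesgue. \<bar>dir_deriv time_dir (cutoff N T) z\<bar> * norm (u z))"
    "s * Re lam * (LINT z|lebesgue. cutoff N T z * norm (u z) powr p) +
      s * Re mu * (LINT z|lebesgue. cutoff N T z * norm (g z) powr q) +
      (LINT z|lebesgue. cutoff N T z * (s * Re (f (snd z))))
    \<le> (LINT z|lebesgue. \<bar>space_laplacian (cutoff N T) z\<bar> * norm (u z)) +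
      (LINT z|lebesgue. \<bar>dir_deriv time_dir (cutoff N T) z\<bar> * norm (u z))"
proof -
  have u: "Lp_loc p (cylinder T) u" using w by (simp add: weak_solution_nonzero_def)
  obtain g where g1: "weak_spatial_gradient T u g" and g: "Lp_loc q (cylinder T) g"
    and eq: "\<And>\<phi>. test_function T \<phi> \<Longrightarrow>
          \<i> * (LINT x|lebesgue. u0 x * of_real (\<phi> (0, x))) +
          spacetime_integral T (\<lambda>z. (lam * of_real (norm (u z) powr p) +
             mu * of_real (norm (g z) powr q) + f (snd z)) * of_real (\<phi> z)) =
          - spacetime_integral T (\<lambda>z. \<Sum>i\<in>UNIV. g z $ i * of_real (dir_deriv (space_dir i) \<phi> z)) -
          \<i> * spacetime_integral T (\<lambda>z. u z * of_real (dir_deriv time_dir \<phi> z))"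
    using w unfolding weak_solution_nonzero_def by blast
  \<comment> \<open>The flux is controlled by an arbitrary \<open>B\<close>, so both bounds come
    from one derivation.\<close>
  have main: "s * Re lam * (LINT z|lebesgue. cutoff N T z * norm (u z) powr p) +
      s * Re mu * (LINT z|lebesgue. cutoff N T z * norm (g z) powr q) +
      (LINT z|lebesgue. cutoff N T z * (s * Re (f (snd z)))) \<le> B +
      (LINT z|lebesgue. \<bar>dir_deriv time_dir (cutoff N T) z\<bar> * norm (u z))"
    if B: "norm (spacetime_integral T
      (\<lambda>z. \<Sum>i\<in>UNIV. g z $ i * of_real (dir_deriv (space_dir i) (cutoff N T) z))) \<le> B" for B
  proof -
    define \<phi> :: "real \<times> (real ^ 'n) \<Rightarrow> real" where "\<phi> = cutoff N T"
    have "s * Re (spacetime_integral T (\<lambda>z. (lam * of_real (norm (u z) powr p) +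
             mu * of_real (norm (g z) powr q) + f (snd z)) * of_real (\<phi> z)))
      \<le> B + (LINT z|lebesgue. \<bar>dir_deriv time_dir \<phi> z\<bar> * norm (u z))"
      using eq[OF cutoff_test_function[OF N T]] cutoff_initial_eq_0[OF N T, where 'n = 'n] B
        Re_diff_le[OF _ spacetime_integral_cutoff(3)[OF u p T continuous_cutoff_derivatives(2)
          cutoff_derivatives_eq_0(2)[OF N T]] s, of "- spacetime_integral T
      (\<lambda>z. \<Sum>i\<in>UNIV. g z $ i * of_real (dir_deriv (space_dir i) (cutoff N T) z))" B]
      by (simp add: \<phi>_def)
    moreover have "(LINT z|lebesgue. \<phi> z * (s * Re (f (snd z)))) = s * (LINT z|lebesgue. \<phi> z * Re (f (snd z)))"
      by (simp add: mult.left_commute)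
    ultimately show ?thesis
      using Re_source_term[OF u g f T N, of lam mu] by (simp add: \<phi>_def distrib_left mult.assoc)
  qed
  \<comment> \<open>Components satisfy |g_i| \<le> |g|, which is why the sum of the |\<partial>_i
    \<phi>| appears in place of the Euclidean norm of the gradient.\<close>
  have flux: "spacetime_integral T (\<lambda>z. \<Sum>i\<in>UNIV. g z $ i * of_real (dir_deriv (space_dir i) (cutoff N T) z)) =
      (\<Sum>i\<in>UNIV. LINT z|lebesgue. g z $ i * of_real (dir_deriv (space_dir i) (cutoff N T) z))"
    "norm (spacetime_integral T (\<lambda>z. \<Sum>i\<in>UNIV. g z $ i * of_real (dir_deriv (space_dir i) (cutoff N T) z))) \<le>
      (LINT z|lebesgue. (\<Sum>i\<in>UNIV. \<bar>dir_deriv (space_dir i) (cutoff N T) z\<bar>) * norm (g z))"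
    "(LINT z|lebesgue. g z $ i * of_real (dir_deriv (space_dir i) (cutoff N T) z)) =
      spacetime_integral T (\<lambda>z. g z $ i * of_real (dir_deriv (space_dir i) (cutoff N T) z))"
    for i
  proof -
    define \<phi> :: "real \<times> (real ^ 'n) \<Rightarrow> real" where "\<phi> = cutoff N T"
    note z0 = cutoff_derivatives_eq_0[OF N T, where 'n = 'n, folded \<phi>_def]
    note c = continuous_cutoff_derivatives[where L = N and T = T and 'n = 'n, folded \<phi>_def]
    note sl = slab_props[OF T, of N, where 'n = 'n]
    have v: "integrable lebesgue (\<lambda>z. dir_deriv (space_dir i) \<phi> z *\<^sub>R g z)" for i
      by (rule integrable_Lp_loc_cutoff(2)[OF g sl c(3) z0(3) q])
    have i: "integrable lebesgue (\<lambda>z. g z $ i * of_real (dir_deriv (space_dir i) \<phi> z))" for i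
      using integrable_bounded_linear[OF bounded_linear_vec_nth v, of i i]
      unfolding vector_scaleR_component by (simp add: scaleR_conv_of_real mult.commute)
    have z: "dir_deriv (space_dir i) \<phi> z = 0" if "z \<notin> cylinder T" for i z
      using z0(3)[of z i] sl(2) that by auto
    have e: "spacetime_integral T (\<lambda>z. \<Sum>i\<in>UNIV. g z $ i * of_real (dir_deriv (space_dir i) \<phi> z)) =
      (LINT z|lebesgue. (\<Sum>i\<in>UNIV. g z $ i * of_real (dir_deriv (space_dir i) \<phi> z)))"
      by (rule spacetime_integral_eq) (auto intro: i simp: z)
    then show "spacetime_integral T (\<lambda>z. \<Sum>i\<in>UNIV. g z $ i * of_real (dir_deriv (space_dir i) (cutoff N T) z)) =
      (\<Sum>i\<in>UNIV. LINT z|lebesgue. g z $ i * of_real (dir_deriv (space_dir i) (cutoff N T) z))"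
      unfolding \<phi>_def[symmetric] by (simp add: i)
    show "(LINT z|lebesgue. g z $ i * of_real (dir_deriv (space_dir i) (cutoff N T) z)) =
      spacetime_integral T (\<lambda>z. g z $ i * of_real (dir_deriv (space_dir i) (cutoff N T) z))"
      unfolding \<phi>_def[symmetric] by (rule spacetime_integral_eq[symmetric]) (auto intro: i simp: z)
    have "integrable lebesgue (\<lambda>z. \<Sum>i\<in>UNIV. norm (dir_deriv (space_dir i) \<phi> z *\<^sub>R g z))"
      by (intro Bochner_Integration.integrable_sum integrable_norm v)
    then have I: "integrable lebesgue (\<lambda>z. (\<Sum>i\<in>UNIV. \<bar>dir_deriv (space_dir i) \<phi> z\<bar>) * norm (g z))"
      by (simp add: sum_distrib_right)
    have "norm (LINT z|lebesgue. (\<Sum>i\<in>UNIV. g z $ i * of_real (dir_deriv (space_dir i) \<phi> z))) \<le>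
      (LINT z|lebesgue. norm (\<Sum>i\<in>UNIV. g z $ i * of_real (dir_deriv (space_dir i) \<phi> z)))"
      by (rule integral_norm_bound)
    also have "\<dots> \<le> (LINT z|lebesgue. (\<Sum>i\<in>UNIV. \<bar>dir_deriv (space_dir i) \<phi> z\<bar>) * norm (g z))"
    proof (rule integral_mono[OF _ I])
      show "integrable lebesgue (\<lambda>z. norm (\<Sum>i\<in>UNIV. g z $ i * of_real (dir_deriv (space_dir i) \<phi> z)))"
        by (intro integrable_norm Bochner_Integration.integrable_sum i)
      show "norm (\<Sum>i\<in>UNIV. g z $ i * of_real (dir_deriv (space_dir i) \<phi> z)) \<le>
          (\<Sum>i\<in>UNIV. \<bar>dir_deriv (space_dir i) \<phi> z\<bar>) * norm (g z)" for z
      proof -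
        have "norm (\<Sum>i\<in>UNIV. g z $ i * of_real (dir_deriv (space_dir i) \<phi> z)) \<le>
            (\<Sum>i\<in>UNIV. norm (g z $ i * of_real (dir_deriv (space_dir i) \<phi> z)))"
          by (rule norm_sum)
        also have "\<dots> \<le> (\<Sum>i\<in>UNIV. \<bar>dir_deriv (space_dir i) \<phi> z\<bar> * norm (g z))"
        proof (rule sum_mono)
          fix i
          show "norm (g z $ i * of_real (dir_deriv (space_dir i) \<phi> z)) \<le> \<bar>dir_deriv (space_dir i) \<phi> z\<bar> * norm (g z)"
            using mult_left_mono[OF Finite_Cartesian_Product.norm_nth_le[of "g z" i], of "\<bar>dir_deriv (space_dir i) \<phi> z\<bar>"]
            by (simp add: norm_mult mult.commute)
        qed
        finally show ?thesis by (simp add: sum_distrib_right)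
      qed
    qed
    finally show "norm (spacetime_integral T (\<lambda>z. \<Sum>i\<in>UNIV. g z $ i * of_real (dir_deriv (space_dir i) (cutoff N T) z))) \<le>
      (LINT z|lebesgue. (\<Sum>i\<in>UNIV. \<bar>dir_deriv (space_dir i) (cutoff N T) z\<bar>) * norm (g z))"
      unfolding e[unfolded \<phi>_def] \<phi>_def .
  qed
  have green: "spacetime_integral T (\<lambda>z. \<Sum>i\<in>UNIV. g z $ i * of_real (dir_deriv (space_dir i) (cutoff N T) z)) =
      - spacetime_integral T (\<lambda>z. u z * of_real (space_laplacian (cutoff N T) z))"
  proof -
    define \<phi> :: "real \<times> (real ^ 'n) \<Rightarrow> real" where "\<phi> = cutoff N T"
    note z0 = cutoff_derivatives_eq_0[OF N T, where 'n = 'n, folded \<phi>_def]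
    note c = continuous_cutoff_derivatives[where L = N and T = T and 'n = 'n, folded \<phi>_def]
    note sl = slab_props[OF T, of N, where 'n = 'n]
    note st = spacetime_integral_cutoff[OF u p T]
    \<comment> \<open>The weak gradient is tested with \<partial>_i \<phi>. This function changes
      sign, which is allowed here, whereas \<open>test_function\<close> requires
      nonnegativity.\<close>
    have parts: "spacetime_integral T (\<lambda>z. g z $ i * of_real (dir_deriv (space_dir i) \<phi> z)) =
      - (LINT z|lebesgue. u z * of_real (dir_deriv (space_dir i) (dir_deriv (space_dir i) \<phi>) z))" for i
    proof -
      have "smooth_on (cylinder T) (dir_deriv (space_dir i) \<phi>)"
        unfolding \<phi>_def
        by (rule smooth_on_subset[OF smooth_on_dir_deriv[OF smooth_cutoff space_dir_in_Basis]]) simp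
      moreover have "compactly_supported_in (cylinder T) (dir_deriv (space_dir i) \<phi>)"
        by (rule compactly_supported_inI[OF sl z0(3)])
      ultimately have "spacetime_integral T (\<lambda>z. u z * of_real (dir_deriv (space_dir i) (dir_deriv (space_dir i) \<phi>) z)) =
        - spacetime_integral T (\<lambda>z. g z $ i * of_real (dir_deriv (space_dir i) \<phi> z))"
        using g1 unfolding weak_spatial_gradient_def by blast
      then show ?thesis using st(2)[OF c(4)[of i] z0(4)] by simp
    qed
    have "spacetime_integral T (\<lambda>z. u z * of_real (space_laplacian \<phi> z)) =
        (LINT z|lebesgue. u z * of_real (space_laplacian \<phi> z))"
      by (rule st(2)[OF c(5) z0(5)])
    also have "\<dots> = (LINT z|lebesgue. (\<Sum>i\<in>UNIV. u z * of_real (dir_deriv (space_dir i) (dir_deriv (space_dir i) \<phi>) z)))"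
      by (simp add: space_laplacian_def sum_distrib_left)
    also have "\<dots> = (\<Sum>i\<in>UNIV. LINT z|lebesgue. u z * of_real (dir_deriv (space_dir i) (dir_deriv (space_dir i) \<phi>) z))"
      by (rule Bochner_Integration.integral_sum) (rule st(1)[OF c(4) z0(4)])
    also have "\<dots> = - (\<Sum>i\<in>UNIV. spacetime_integral T (\<lambda>z. g z $ i * of_real (dir_deriv (space_dir i) \<phi> z)))"
      by (simp add: parts sum_negf)
    also have "\<dots> = - spacetime_integral T (\<lambda>z. \<Sum>i\<in>UNIV. g z $ i * of_real (dir_deriv (space_dir i) \<phi> z))"
      using flux(1,3) by (simp add: \<phi>_def)
    finally show ?thesis by (simp add: \<phi>_def)
  qed
  show thesis
  proof (rule that[OF g])
    show "s * Re lam * (LINT z|lebesgue. cutoff N T z * norm (u z) powr p) +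
      s * Re mu * (LINT z|lebesgue. cutoff N T z * norm (g z) powr q) +
      (LINT z|lebesgue. cutoff N T z * (s * Re (f (snd z))))
    \<le> (LINT z|lebesgue. (\<Sum>i\<in>UNIV. \<bar>dir_deriv (space_dir i) (cutoff N T) z\<bar>) * norm (g z)) +
      (LINT z|lebesgue. \<bar>dir_deriv time_dir (cutoff N T) z\<bar> * norm (u z))"
      by (rule main[OF flux(2)])
    show "s * Re lam * (LINT z|lebesgue. cutoff N T z * norm (u z) powr p) +
      s * Re mu * (LINT z|lebesgue. cutoff N T z * norm (g z) powr q) +
      (LINT z|lebesgue. cutoff N T z * (s * Re (f (snd z))))
    \<le> (LINT z|lebesgue. \<bar>space_laplacian (cutoff N T) z\<bar> * norm (u z)) +
      (LINT z|lebesgue. \<bar>dir_deriv time_dir (cutoff N T) z\<bar> * norm (u z))"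
      by (rule main) (use spacetime_integral_cutoff(3)[OF u p T continuous_cutoff_derivatives(5)
          cutoff_derivatives_eq_0(5)[OF N T]] in \<open>simp add: green\<close>)
  qed
qed

section \<open>Contradiction in the three critical cases\<close>

lemma no_global_weak_solution_zero:
  fixes u0 f :: "real ^ 'n \<Rightarrow> complex"
  assumes n: "CARD('n) \<ge> 3" and p: "p = real CARD('n) / (real CARD('n) - 2)"
    and f: "integrable lebesgue (\<lambda>x. Re (f x))" "integrable lebesgue (\<lambda>x. Im (f x))"
    and pos: "Re lam * (LINT x|lebesgue. Re (f x)) > 0"
    and w: "\<And>T. T > 0 \<Longrightarrow> weak_solution_zero lam p f u0 T u"
  shows False
proof -
  \<comment> \<open>Multiplying by this sign makes both the coefficient of |u|^p and the integral of
    the source positive, while the estimate forces the latter to be at most 0.\<close>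
  define s where "s = sgn (Re lam)"
  have s: "s = 1 \<or> s = - 1" and l: "s * Re lam > 0" and F: "s * (LINT x|lebesgue. Re (f x)) > 0"
    using pos by (auto simp: s_def sgn_if zero_less_mult_iff)
  have p1: "p \<ge> 1" using n by (simp add: p)
  have "(LINT x|lebesgue. s * Re (f x)) \<le> 0"
  proof (rule integral_nonpos_of_diffusion_bound[OF n p l])
    show "Lp_loc p (cylinder T) u" if "T > 0" for T
      using w[OF that] by (simp add: weak_solution_zero_def)
    show "s * Re lam * (LINT z|lebesgue. cutoff (real N) T z * norm (u z) powr p) +
        (LINT z|lebesgue. cutoff (real N) T z * (s * Re (f (snd z))))
      \<le> (LINT z|lebesgue. \<bar>space_laplacian (cutoff (real N) T) z\<bar> * norm (u z)) +
        (LINT z|lebesgue. \<bar>dir_deriv time_dir (cutoff (real N) T) z\<bar> * norm (u z))" if "N \<ge> 1" "T > 0" for N T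
      by (rule weak_solution_zero_bound[OF w[OF that(2)] p1 that(2) _ f s]) (use that in simp)
  qed (use f in auto)
  then show False using F by simp
qed

text \<open>In the second bound of \<open>weak_solution_nonzero_bound\<close> the gradient occurs
  only with coefficient \<open>s * Re mu \<ge> 0\<close>. That term is dropped, and the diffusion
  estimate applies as it stands.\<close>

lemma no_global_weak_solution_nonzero_critical_p:
  fixes u0 f :: "real ^ 'n \<Rightarrow> complex"
  assumes n: "CARD('n) \<ge> 3" and p: "p = real CARD('n) / (real CARD('n) - 2)" and q: "q > 1"
    and f: "integrable lebesgue (\<lambda>x. Re (f x))" "integrable lebesgue (\<lambda>x. Im (f x))"
    and lm: "Re lam * Re mu \<ge> 0" and pos: "Re lam * (LINT x|lebesgue. Re (f x)) > 0"
    and w: "\<And>T. T > 0 \<Longrightarrow> weak_solution_nonzero lam mu p q f u0 T u"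
  shows False
proof -
  define s where "s = sgn (Re lam)"
  have s: "s = 1 \<or> s = - 1" and l: "s * Re lam > 0" and F: "s * (LINT x|lebesgue. Re (f x)) > 0"
    and m: "s * Re mu \<ge> 0"
    using pos lm by (auto simp: s_def sgn_if zero_less_mult_iff zero_le_mult_iff)
  have p1: "p \<ge> 1" using n by (simp add: p)
  have "(LINT x|lebesgue. s * Re (f x)) \<le> 0"
  proof (rule integral_nonpos_of_diffusion_bound[OF n p l])
    show "Lp_loc p (cylinder T) u" if "T > 0" for T
      using w[OF that] by (simp add: weak_solution_nonzero_def)
    fix N :: nat and T :: real
    assume NT: "N \<ge> 1" "T > 0"
    then have N0: "real N > 0" by simp
    obtain g :: "real \<times> (real ^ 'n) \<Rightarrow> complex ^ 'n" where
      g: "s * Re lam * (LINT z|lebesgue. cutoff (real N) T z * norm (u z) powr p) +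
      s * Re mu * (LINT z|lebesgue. cutoff (real N) T z * norm (g z) powr q) +
      (LINT z|lebesgue. cutoff (real N) T z * (s * Re (f (snd z))))
    \<le> (LINT z|lebesgue. \<bar>space_laplacian (cutoff (real N) T) z\<bar> * norm (u z)) +
      (LINT z|lebesgue. \<bar>dir_deriv time_dir (cutoff (real N) T) z\<bar> * norm (u z))"
      by (rule weak_solution_nonzero_bound[OF w[OF NT(2)] p1 less_imp_le[OF q] NT(2) N0 f s]) (rule that)
    moreover have "0 \<le> s * Re mu * (LINT z|lebesgue. cutoff (real N) T z * norm (g z) powr q)"
      by (intro mult_nonneg_nonneg[OF m] integral_nonneg_AE AE_I2 mult_nonneg_nonneg[OF cutoff_nonneg]) simp
    ultimately show "s * Re lam * (LINT z|lebesgue. cutoff (real N) T z * norm (u z) powr p) +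
      (LINT z|lebesgue. cutoff (real N) T z * (s * Re (f (snd z))))
    \<le> (LINT z|lebesgue. \<bar>space_laplacian (cutoff (real N) T) z\<bar> * norm (u z)) +
      (LINT z|lebesgue. \<bar>dir_deriv time_dir (cutoff (real N) T) z\<bar> * norm (u z))"
      by linarith
  qed (use f in auto)
  then show False using F by simp
qed

text \<open>The sign is taken from \<open>mu\<close>; \<open>Re lam\<close> has the same one, so
  both nonlinear terms have positive coefficients and both can absorb.\<close>

lemma no_global_weak_solution_nonzero_critical_q:
  fixes u0 f :: "real ^ 'n \<Rightarrow> complex"
  assumes n: "CARD('n) \<ge> 2" and q: "q = real CARD('n) / (real CARD('n) - 1)" and p: "p > 1"
    and f: "integrable lebesgue (\<lambda>x. Re (f x))" "integrable lebesgue (\<lambda>x. Im (f x))"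
    and lm: "Re lam * Re mu > 0" and pos: "Re mu * (LINT x|lebesgue. Re (f x)) > 0"
    and w: "\<And>T. T > 0 \<Longrightarrow> weak_solution_nonzero lam mu p q f u0 T u"
  shows False
proof -
  define s where "s = sgn (Re mu)"
  have s: "s = 1 \<or> s = - 1" and l: "s * Re lam > 0" and F: "s * (LINT x|lebesgue. Re (f x)) > 0"
    and m: "s * Re mu > 0"
    using pos lm by (auto simp: s_def sgn_if zero_less_mult_iff)
  have q1: "q \<ge> 1" using n by (simp add: q)
  have "(LINT x|lebesgue. s * Re (f x)) \<le> 0"
  proof (rule integral_nonpos_of_gradient_bound[OF n q p l m])
    show "Lp_loc p (cylinder T) u" if "T > 0" for T
      using w[OF that] by (simp add: weak_solution_nonzero_def)
    fix N :: nat and T :: real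
    assume NT: "N \<ge> 1" "T > 0"
    then have N0: "real N > 0" by simp
    show "\<exists>g :: real \<times> (real ^ 'n) \<Rightarrow> complex ^ 'n. Lp_loc q (cylinder T) g \<and>
      s * Re lam * (LINT z|lebesgue. cutoff (real N) T z * norm (u z) powr p) +
      s * Re mu * (LINT z|lebesgue. cutoff (real N) T z * norm (g z) powr q) +
      (LINT z|lebesgue. cutoff (real N) T z * (s * Re (f (snd z))))
    \<le> (LINT z|lebesgue. (\<Sum>i\<in>UNIV. \<bar>dir_deriv (space_dir i) (cutoff (real N) T) z\<bar>) * norm (g z)) +
      (LINT z|lebesgue. \<bar>dir_deriv time_dir (cutoff (real N) T) z\<bar> * norm (u z))"
      by (rule weak_solution_nonzero_bound[OF w[OF NT(2)] less_imp_le[OF p] q1 NT(2) N0 f s]) (intro exI conjI)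
  qed (use f in auto)
  then show False using F by simp
qed

theorem theorem1p3:
  fixes u0 f :: "real ^ 'n \<Rightarrow> complex" and lam mu :: complex and p q :: real
  assumes "Lp_loc 1 UNIV u0" and "Lp_loc 1 UNIV f" and "lam \<noteq> 0"
  shows
    "(mu = 0 \<and> CARD('n) \<ge> 3 \<and> p = real CARD('n) / (real CARD('n) - 2) \<and>
      integrable lebesgue (\<lambda>x. Re (f x)) \<and> integrable lebesgue (\<lambda>x. Im (f x)) \<and>
      Re lam * (LINT x|lebesgue. Re (f x)) > 0 \<and> Im lam * (LINT x|lebesgue. Im (f x)) > 0
      \<longrightarrow> \<not> (\<exists>u. global_weak_solution lam mu p q f u0 u))
     \<and>
     (mu \<noteq> 0 \<and>
      ((CARD('n) \<ge> 3 \<and> p = real CARD('n) / (real CARD('n) - 2) \<and> q > 1 \<and>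
        Re lam * Re mu \<ge> 0 \<and> Im lam * Im mu \<ge> 0 \<and>
        integrable lebesgue (\<lambda>x. Re (f x)) \<and> integrable lebesgue (\<lambda>x. Im (f x)) \<and>
        Re lam * (LINT x|lebesgue. Re (f x)) > 0 \<and> Im lam * (LINT x|lebesgue. Im (f x)) > 0)
       \<or>
       (CARD('n) \<ge> 2 \<and> q = real CARD('n) / (real CARD('n) - 1) \<and> p > 1 \<and>
        Re lam * Re mu > 0 \<and> Im lam * Im mu > 0 \<and>
        integrable lebesgue (\<lambda>x. Re (f x)) \<and> integrable lebesgue (\<lambda>x. Im (f x)) \<and>
        Re mu * (LINT x|lebesgue. Re (f x)) > 0 \<and> Im mu * (LINT x|lebesgue. Im (f x)) > 0))
      \<longrightarrow> \<not> (\<exists>u. global_weak_solution lam mu p q f u0 u))"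
proof (intro conjI impI notI; elim conjE exE disjE)
  fix u :: "real \<times> (real ^ 'n) \<Rightarrow> complex"
  assume u: "global_weak_solution lam mu p q f u0 u"
  {
    assume h: "mu = 0" "CARD('n) \<ge> 3" "p = real CARD('n) / (real CARD('n) - 2)"
      "integrable lebesgue (\<lambda>x. Re (f x))" "integrable lebesgue (\<lambda>x. Im (f x))"
      "Re lam * (LINT x|lebesgue. Re (f x)) > 0"
    have "weak_solution_zero lam p f u0 T u" if "T > 0" for T
      using u h(1) that by (simp add: global_weak_solution_def)
    then show False by (rule no_global_weak_solution_zero[OF h(2-6)])
  }
  assume "mu \<noteq> 0"
  then have w: "weak_solution_nonzero lam mu p q f u0 T u" if "T > 0" for T
    using u that by (simp add: global_weak_solution_def)
  {
    assume h: "CARD('n) \<ge> 3" "p = real CARD('n) / (real CARD('n) - 2)" "q > 1"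
      "integrable lebesgue (\<lambda>x. Re (f x))" "integrable lebesgue (\<lambda>x. Im (f x))"
      "Re lam * Re mu \<ge> 0" "Re lam * (LINT x|lebesgue. Re (f x)) > 0"
    show False by (rule no_global_weak_solution_nonzero_critical_p[OF h w])
  }
  {
    assume h: "CARD('n) \<ge> 2" "q = real CARD('n) / (real CARD('n) - 1)" "p > 1"
      "integrable lebesgue (\<lambda>x. Re (f x))" "integrable lebesgue (\<lambda>x. Im (f x))"
      "Re lam * Re mu > 0" "Re mu * (LINT x|lebesgue. Re (f x)) > 0"
    show False by (rule no_global_weak_solution_nonzero_critical_q[OF h w])
  }
qed

end
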